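(* Let $f(n)$ be the number of $2$-boolean permutations in $S_n$ (with $f(0)=1$). Then $$\sum_{n\ge0}f(n)q^n=\frac{1-5q+5q^2}{1-6q+9q^2-3q^3}.$$
   Context: A permutation $w\in S_n$ is $2$-boolean if no reduced word of $w$ in the simple transpositions $s_i=(i\ i+1)$ contains some $s_i$ more than twice. *)

theory Defs
  imports "HOL-Combinatorics.Permutations" "HOL-Computational_Algebra.Formal_Power_Series"
begin

text \<open>Elements of $S_n$ are the functions \<^term>\<open>w :: nat \<Rightarrow> nat\<close> with \<^term>\<open>w permutes {1..n}\<close>.\<close>

definition simple_transposition :: "nat \<Rightarrow> nat \<Rightarrow> nat" where
  "simple_transposition i = transpose i (Suc i)"

definition word_prod :: "nat list \<Rightarrow> nat \<Rightarrow> nat" where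
  "word_prod xs = foldr (\<circ>) (map simple_transposition xs) id"

definition word_for :: "nat \<Rightarrow> (nat \<Rightarrow> nat) \<Rightarrow> nat list \<Rightarrow> bool" where
  "word_for n w xs \<longleftrightarrow> set xs \<subseteq> {1..<n} \<and> word_prod xs = w"

definition reduced_word :: "nat \<Rightarrow> (nat \<Rightarrow> nat) \<Rightarrow> nat list \<Rightarrow> bool" where
  "reduced_word n w xs \<longleftrightarrow>
     word_for n w xs \<and> (\<forall>ys. word_for n w ys \<longrightarrow> length xs \<le> length ys)"

definition two_boolean :: "nat \<Rightarrow> (nat \<Rightarrow> nat) \<Rightarrow> bool" where
  "two_boolean n w \<longleftrightarrow>
     w permutes {1..n} \<and> \<not> (\<exists>xs i. reduced_word n w xs \<and> count_list xs i > 2)"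

definition num_two_boolean :: "nat \<Rightarrow> nat" where
  "num_two_boolean n = card {w. two_boolean n w}"

text \<open>The convention $f(0) = 1$ needs no special case: $S_0$ consists of the identity only.\<close>

lemma num_two_boolean_0: "num_two_boolean 0 = 1"
proof -
  have "reduced_word 0 w xs \<Longrightarrow> xs = []" for w xs
    by (auto simp: reduced_word_def word_for_def)
  hence "{w. two_boolean 0 w} = {id}"
    by (fastforce simp: two_boolean_def)
  thus ?thesis by (simp add: num_two_boolean_def)
qed

end

theory Submission
  imports Defs
begin

text \<open>
  In one-line notation, appending \<^term>\<open>i\<close> to a word exchanges the entries at positions
  \<^term>\<open>i\<close> and \<^term>\<open>Suc i\<close>, and a word is reduced iff every such exchange creates an inversion.
  If a reduced word uses $s_k$ three times, then the three pairs of values exchanged across the cut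
  between positions $k$ and $k + 1$ force one of the patterns 4312, 4321 / 3421, 4321 / six entries
  of which the first three all exceed the last three. Conversely, undoing descents that keep such a
  pattern ends at a permutation where it occupies consecutive positions, and there a suitable
  sequence of descents uses the middle position three times.

  A permutation avoids these patterns iff its excedance values increase, its deficiency values
  increase, at most two values cross any cut, and at most one crosses the cut after a fixed point.
  Reading such a permutation through growing squares $\{1..k\}^2$, only the number of crossings
  (0, 1 or 2) matters for the number of continuations: the two monotonicity conditions say that open
  positions and unused values are served first in, first out. The resulting three-state transfer
  matrix gives the recurrence $f(n+3) = 6 f(n+2) - 9 f(n+1) + 3 f(n)$.
\<close>

subsection \<open>Inversions and reduced words\<close>

definition inversion :: "(nat \<Rightarrow> nat) \<Rightarrow> nat \<Rightarrow> nat \<Rightarrow> bool" where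
  "inversion w a b \<longleftrightarrow> a < b \<and> w b < w a"

definition inversions :: "(nat \<Rightarrow> nat) \<Rightarrow> (nat \<times> nat) set" where
  "inversions w = {(a, b). inversion w a b}"

abbreviation swap :: "(nat \<Rightarrow> nat) \<Rightarrow> nat \<Rightarrow> nat \<Rightarrow> nat" where
  "swap w i \<equiv> w \<circ> simple_transposition i"

lemma simple_transposition_apply:
  "simple_transposition i x = (if x = i then Suc i else if x = Suc i then i else x)"
  by (simp add: simple_transposition_def transpose_def)

lemma simple_transposition_involutory [simp]:
  "simple_transposition i (simple_transposition i x) = x"
  by (simp add: simple_transposition_def)

lemma swap_swap [simp]: "swap (swap w i) i = w"
  by (simp add: fun_eq_iff)

lemma bij_simple_transposition [simp]: "bij (simple_transposition i)"
  by (simp add: simple_transposition_def)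

lemma simple_transposition_eq_iff [simp]:
  "simple_transposition i x = simple_transposition i y \<longleftrightarrow> x = y"
  by (metis simple_transposition_involutory)

lemma simple_transposition_less:
  "a < b \<Longrightarrow> (a, b) \<noteq> (i, Suc i) \<Longrightarrow> simple_transposition i a < simple_transposition i b"
  by (auto simp: simple_transposition_apply)

lemma simple_transposition_permutes: "i \<in> {1..<n} \<Longrightarrow> simple_transposition i permutes {1..n}"
  unfolding simple_transposition_def by (rule permutes_swap_id) auto

lemma swap_permutes: "w permutes {1..n} \<Longrightarrow> i \<in> {1..<n} \<Longrightarrow> swap w i permutes {1..n}"
  using simple_transposition_permutes permutes_compose by blast

lemma permutes_less_Suc_cases:
  assumes "(w :: nat \<Rightarrow> nat) permutes S"
  shows "w i < w (Suc i) \<or> w (Suc i) < w i"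
proof -
  have "w i \<noteq> w (Suc i)" using inj_eq[OF permutes_inj[OF assms]] by simp
  thus ?thesis by linarith
qed

text \<open>Positions travel with their values, so only the order of the positions is at stake, and
  \<open>(i, Suc i)\<close> is the only pair of positions whose order the exchange reverses.\<close>

lemma inversion_swap_descent:
  "inversion w a b \<Longrightarrow> (a, b) \<noteq> (i, Suc i) \<Longrightarrow>
    inversion (swap w i) (simple_transposition i a) (simple_transposition i b)"
  using simple_transposition_less[of a b i] by (auto simp: inversion_def)

lemma inversion_swap_ascent:
  assumes "inversion w a b" "w i < w (Suc i)"
  shows "inversion (swap w i) (simple_transposition i a) (simple_transposition i b)"
  using assms by (intro inversion_swap_descent) (auto simp: inversion_def)

text \<open>Outside \<open>{1..n}\<close> everything is fixed: 0 is below all other values, and a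
  fixed position above \<open>n\<close> has only smaller values to its left.\<close>

lemma inversion_in_range:
  assumes "w permutes {1..n}" "inversion w a b"
  shows "1 \<le> a" "a < b" "b \<le> n"
proof -
  show "a < b" using assms by (simp add: inversion_def)
  show "1 \<le> a"
  proof (rule ccontr)
    assume "\<not> 1 \<le> a"
    hence "w a = 0" using permutes_not_in[OF assms(1), of a] by auto
    thus False using assms(2) by (simp add: inversion_def)
  qed
  show "b \<le> n"
  proof (rule ccontr)
    assume "\<not> b \<le> n"
    hence wb: "w b = b" using permutes_not_in[OF assms(1), of b] by auto
    hence "b < w a" "a < b" using assms(2) by (auto simp: inversion_def)
    thus False using \<open>\<not> b \<le> n\<close> permutes_in_image[OF assms(1), of a] permutes_not_in[OF assms(1), of a]
      by (cases "a \<in> {1..n}") auto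
  qed
qed

lemma finite_inversions: "w permutes {1..n} \<Longrightarrow> finite (inversions w)"
proof (rule finite_subset[of _ "{1..n} \<times> {1..n}"])
  assume w: "w permutes {1..n}"
  show "inversions w \<subseteq> {1..n} \<times> {1..n}"
  proof (rule subrelI)
    fix a b assume "(a, b) \<in> inversions w"
    hence "inversion w a b" by (simp add: inversions_def)
    from inversion_in_range[OF w this] show "(a, b) \<in> {1..n} \<times> {1..n}" by simp
  qed
qed simp

text \<open>The old inversions travel along with their positions. The only new one is
  \<open>(i, Suc i)\<close>, which is no image of an old one because its preimage
  \<open>(Suc i, i)\<close> is not increasing.\<close>

lemma card_inversions_swap_ascent:
  assumes w: "w permutes {1..n}" and lt: "w i < w (Suc i)"
  shows "card (inversions (swap w i)) = Suc (card (inversions w))"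
proof -
  let ?s = "simple_transposition i"
  have "inversions (swap w i) = insert (i, Suc i) (map_prod ?s ?s ` inversions w)" (is "?A = ?B")
  proof
    show "?B \<subseteq> ?A"
    proof -
      have "inversion (swap w i) i (Suc i)"
        using lt by (simp add: inversion_def simple_transposition_apply)
      thus ?thesis using inversion_swap_ascent[OF _ lt] by (auto simp: inversions_def)
    qed
    show "?A \<subseteq> ?B"
    proof (rule subrelI)
      fix a b assume "(a, b) \<in> ?A"
      hence ab: "inversion (swap w i) a b" by (simp add: inversions_def)
      show "(a, b) \<in> ?B"
      proof (cases "(a, b) = (i, Suc i)")
        case False
        from inversion_swap_descent[OF ab this]
        have "inversion w (?s a) (?s b)" by (simp only: swap_swap)
        hence "map_prod ?s ?s (?s a, ?s b) \<in> map_prod ?s ?s ` inversions w"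
          by (intro imageI) (simp add: inversions_def)
        thus ?thesis by simp
      qed simp
    qed
  qed
  moreover have "(i, Suc i) \<notin> map_prod ?s ?s ` inversions w"
  proof
    assume "(i, Suc i) \<in> map_prod ?s ?s ` inversions w"
    then obtain a b where "inversion w a b" "i = ?s a" "Suc i = ?s b"
      by (auto simp: inversions_def)
    thus False by (auto simp: inversion_def simple_transposition_apply split: if_splits)
  qed
  moreover have "card (map_prod ?s ?s ` inversions w) = card (inversions w)"
    by (intro card_image) (auto simp: inj_on_def)
  ultimately show ?thesis using finite_inversions[OF w] by simp
qed

lemma card_inversions_swap_descent:
  assumes w: "w permutes {1..n}" and i: "i \<in> {1..<n}" and lt: "w (Suc i) < w i"
  shows "card (inversions w) = Suc (card (inversions (swap w i)))"
  using card_inversions_swap_ascent[OF swap_permutes[OF w i], of i] lt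
  by (simp only: swap_swap) (simp add: simple_transposition_apply)

section \<open>Words and their length in terms of inversions\<close>

lemma word_prod_Nil [simp]: "word_prod [] = id"
  by (simp add: word_prod_def)

lemma word_prod_Cons: "word_prod (x # xs) = simple_transposition x \<circ> word_prod xs"
  by (simp add: word_prod_def)

lemma word_prod_append: "word_prod (xs @ ys) = word_prod xs \<circ> word_prod ys"
  by (induction xs) (simp_all add: word_prod_Cons comp_assoc)

lemma word_prod_snoc: "word_prod (xs @ [i]) = swap (word_prod xs) i"
  by (simp add: word_prod_append word_prod_Cons)

lemma word_prod_permutes: "set xs \<subseteq> {1..<n} \<Longrightarrow> word_prod xs permutes {1..n}"
proof (induction xs rule: rev_induct)
  case (snoc x xs)
  show ?case unfolding word_prod_snoc by (rule swap_permutes) (use snoc in auto)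
qed (simp add: permutes_id)

lemma card_inversions_swap_le:
  assumes w: "w permutes {1..n}" and i: "i \<in> {1..<n}"
  shows "card (inversions (swap w i)) \<le> Suc (card (inversions w))"
  using permutes_less_Suc_cases[OF w, of i] card_inversions_swap_ascent[OF w, of i]
    card_inversions_swap_descent[OF w i] by linarith

lemma card_inversions_append_le:
  assumes "set (xs @ ys) \<subseteq> {1..<n}"
  shows "card (inversions (word_prod (xs @ ys))) \<le> card (inversions (word_prod xs)) + length ys"
  using assms
proof (induction ys rule: rev_induct)
  case (snoc y ys)
  have "card (inversions (word_prod ((xs @ ys) @ [y]))) \<le> Suc (card (inversions (word_prod (xs @ ys))))"
    unfolding word_prod_snoc using snoc.prems
    by (intro card_inversions_swap_le[of _ n] word_prod_permutes) auto
  thus ?case using snoc by simp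
qed simp

lemma inversions_id [simp]: "inversions id = {}"
  by (auto simp: inversions_def inversion_def)

lemma card_inversions_le_length:
  "set xs \<subseteq> {1..<n} \<Longrightarrow> card (inversions (word_prod xs)) \<le> length xs"
  using card_inversions_append_le[of "[]" xs n] by simp

text \<open>Each step upwards adds at least one. Starting from \<open>1 \<le> w 1\<close> this
  bounds \<open>w i\<close> from below; going down from \<open>w n \<le> n\<close> it bounds
  \<open>w i\<close> from above.\<close>

lemma ascending_eq_id:
  assumes w: "w permutes {1..n}" and asc: "\<And>i. i \<in> {1..<n} \<Longrightarrow> w i < w (Suc i)"
  shows "w = id"
proof -
  have le: "i \<le> w i" if "i \<le> n" for i
    using that
  proof (induction i)
    case (Suc i)
    show ?case
    proof (cases "i = 0")
      case True
      thus ?thesis using permutes_in_image[OF w, of 1] Suc.prems by simp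
    next
      case False
      thus ?thesis using Suc asc[of i] by auto
    qed
  qed simp
  have "w i \<le> i" if "i \<le> n" for i
    using that
  proof (induction "n - i" arbitrary: i)
    case 0
    thus ?case using permutes_in_image[OF w, of n] permutes_not_in[OF w, of i]
      by (cases "i = 0") auto
  next
    case (Suc d)
    show ?case
    proof (cases "i = 0")
      case True
      thus ?thesis using permutes_not_in[OF w, of 0] by simp
    next
      case False
      thus ?thesis using Suc.hyps(1)[of "Suc i"] Suc.hyps(2) asc[of i] by fastforce
    qed
  qed
  with le have "w i = i" if "i \<le> n" for i using that by (simp add: antisym)
  hence "w i = i" for i using permutes_not_in[OF w, of i] by (cases "i \<le> n") auto
  thus ?thesis by (simp add: fun_eq_iff)
qed

text \<open>Undoing descents one at a time loses one inversion each and can stop only at the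
  identity; the undone letters, read backwards, spell the word.\<close>

lemma word_of_length_inversions:
  assumes "w permutes {1..n}"
  shows "\<exists>xs. word_for n w xs \<and> length xs = card (inversions w)"
  using assms
proof (induction "card (inversions w)" arbitrary: w rule: less_induct)
  case less
  show ?case
  proof (cases "\<exists>i \<in> {1..<n}. w (Suc i) < w i")
    case True
    then obtain i where i: "i \<in> {1..<n}" "w (Suc i) < w i" by blast
    note c = card_inversions_swap_descent[OF less.prems i]
    obtain xs where xs: "word_for n (swap w i) xs" "length xs = card (inversions (swap w i))"
      using less.hyps[OF _ swap_permutes[OF less.prems i(1)]] c by auto
    have "word_prod (xs @ [i]) = w"
      using xs(1) unfolding word_prod_snoc word_for_def by (metis swap_swap)
    thus ?thesis using xs c i(1) by (intro exI[of _ "xs @ [i]"]) (simp add: word_for_def)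
  next
    case False
    have "w i < w (Suc i)" if "i \<in> {1..<n}" for i
      using False that permutes_less_Suc_cases[OF less.prems, of i] by blast
    hence "w = id" using ascending_eq_id[OF less.prems] by blast
    thus ?thesis by (intro exI[of _ "[]"]) (simp add: word_for_def)
  qed
qed

text \<open>A letter adds at most one inversion, so no word is shorter than the inversion number,
  and undoing descents attains this bound.\<close>

lemma reduced_word_iff:
  assumes "w permutes {1..n}"
  shows "reduced_word n w xs \<longleftrightarrow> word_for n w xs \<and> length xs = card (inversions w)"
proof -
  have "card (inversions w) \<le> length ys" if "word_for n w ys" for ys
    using that card_inversions_le_length[of ys n] by (auto simp: word_for_def)
  thus ?thesis
    using word_of_length_inversions[OF assms] unfolding reduced_word_def by (metis order.antisym)
qed

text \<open>A letter applied at a descent would lose an inversion, and the remaining letters could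
  not make up for it.\<close>

lemma reduced_word_ascent:
  assumes "w permutes {1..n}" "reduced_word n w (xs @ i # ys)"
  shows "word_prod xs i < word_prod xs (Suc i)"
proof (rule ccontr)
  assume neg: "\<not> ?thesis"
  have s: "set xs \<subseteq> {1..<n}" "i \<in> {1..<n}" "set ys \<subseteq> {1..<n}"
    and p: "word_prod ((xs @ [i]) @ ys) = w" and l: "length xs + length ys + 1 = card (inversions w)"
    using assms(2) unfolding reduced_word_iff[OF assms(1)] by (auto simp: word_for_def)
  note q = word_prod_permutes[OF s(1)]
  have "word_prod xs (Suc i) < word_prod xs i"
    using neg permutes_less_Suc_cases[OF q, of i] by blast
  from card_inversions_swap_descent[OF q s(2) this] card_inversions_le_length[OF s(1)]
  have "card (inversions (word_prod (xs @ [i]))) < length xs" by (simp add: word_prod_snoc)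
  thus False using card_inversions_append_le[of "xs @ [i]" ys n] s p l by auto
qed

lemma reduced_word_snoc:
  assumes w: "w permutes {1..n}" and i: "i \<in> {1..<n}" "w (Suc i) < w i"
    and r: "reduced_word n (swap w i) xs"
  shows "reduced_word n w (xs @ [i])"
proof -
  have "word_prod (xs @ [i]) = w"
    using r unfolding word_prod_snoc word_for_def reduced_word_def by (metis swap_swap)
  thus ?thesis
    using r i(1) card_inversions_swap_descent[OF w i]
    unfolding reduced_word_iff[OF w] reduced_word_iff[OF swap_permutes[OF w i(1)]] word_for_def
    by simp
qed

text \<open>The list names descents that are undone one after the other; reversed, it becomes the
  end of a reduced word.\<close>

fun descending :: "(nat \<Rightarrow> nat) \<Rightarrow> nat list \<Rightarrow> bool" where
  "descending w [] \<longleftrightarrow> True"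
| "descending w (i # js) \<longleftrightarrow> w (Suc i) < w i \<and> descending (swap w i) js"

lemma reduced_word_descending:
  assumes "w permutes {1..n}" "set js \<subseteq> {1..<n}" "descending w js"
  shows "\<exists>xs. reduced_word n w (xs @ rev js)"
  using assms
proof (induction js arbitrary: w)
  case Nil
  thus ?case using word_of_length_inversions reduced_word_iff by auto
next
  case (Cons i js)
  obtain xs where "reduced_word n (swap w i) (xs @ rev js)"
    using Cons swap_permutes[OF Cons.prems(1), of i] by auto
  from reduced_word_snoc[OF Cons.prems(1) _ _ this] Cons.prems show ?case by auto
qed

subsection \<open>Three occurrences of a generator force a pattern\<close>

text \<open>Leaving the order of \<open>c\<close> and \<open>d\<close> open covers 4312 and 4321
  together; likewise \<open>forbidden2\<close> covers 3421 and 4321. All three patterns demand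
  inversions only, so an exchange at an ascent, which keeps every inversion, cannot destroy
  them.\<close>

definition forbidden1 :: "(nat \<Rightarrow> nat) \<Rightarrow> bool" where
  "forbidden1 w \<longleftrightarrow> (\<exists>a b c d. c \<noteq> d \<and> inversion w a b \<and> inversion w b c \<and> inversion w b d)"

definition forbidden2 :: "(nat \<Rightarrow> nat) \<Rightarrow> bool" where
  "forbidden2 w \<longleftrightarrow> (\<exists>a b c d. a \<noteq> b \<and> inversion w a c \<and> inversion w b c \<and> inversion w c d)"

definition forbidden3 :: "(nat \<Rightarrow> nat) \<Rightarrow> bool" where
  "forbidden3 w \<longleftrightarrow> (\<exists>A B. card A = 3 \<and> card B = 3 \<and> (\<forall>a\<in>A. \<forall>b\<in>B. inversion w a b))"

definition forbidden :: "(nat \<Rightarrow> nat) \<Rightarrow> bool" where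
  "forbidden w \<longleftrightarrow> forbidden1 w \<or> forbidden2 w \<or> forbidden3 w"

lemma forbidden_swap_ascent:
  assumes f: "forbidden w" and lt: "w i < w (Suc i)"
  shows "forbidden (swap w i)"
proof -
  let ?s = "simple_transposition i"
  note p = inversion_swap_ascent[OF _ lt]
  consider "forbidden1 w" | "forbidden2 w" | "forbidden3 w" using f by (auto simp: forbidden_def)
  thus ?thesis
  proof cases
    case 1
    then obtain a b c d where "c \<noteq> d" "inversion w a b" "inversion w b c" "inversion w b d"
      by (auto simp: forbidden1_def)
    hence "forbidden1 (swap w i)"
      unfolding forbidden1_def using p
      by (intro exI[of _ "?s a"] exI[of _ "?s b"] exI[of _ "?s c"] exI[of _ "?s d"]) simp
    thus ?thesis by (simp add: forbidden_def)
  next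
    case 2
    then obtain a b c d where "a \<noteq> b" "inversion w a c" "inversion w b c" "inversion w c d"
      by (auto simp: forbidden2_def)
    hence "forbidden2 (swap w i)"
      unfolding forbidden2_def using p
      by (intro exI[of _ "?s a"] exI[of _ "?s b"] exI[of _ "?s c"] exI[of _ "?s d"]) simp
    thus ?thesis by (simp add: forbidden_def)
  next
    case 3
    then obtain A B where "card A = 3" "card B = 3" "\<forall>a\<in>A. \<forall>b\<in>B. inversion w a b"
      by (auto simp: forbidden3_def)
    hence "forbidden3 (swap w i)"
      unfolding forbidden3_def using p
      by (intro exI[of _ "?s ` A"] exI[of _ "?s ` B"]) (simp add: card_image inj_on_def)
    thus ?thesis by (simp add: forbidden_def)
  qed
qed

lemma forbidden_reduced_word_append:
  assumes w: "w permutes {1..n}" and r: "reduced_word n w (xs @ ys)" and f: "forbidden (word_prod xs)"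
  shows "forbidden w"
  using r f
proof (induction ys arbitrary: xs)
  case Nil
  thus ?case by (simp add: reduced_word_def word_for_def)
next
  case (Cons y ys)
  have "forbidden (word_prod (xs @ [y]))"
    unfolding word_prod_snoc
    using forbidden_swap_ascent[OF Cons.prems(2) reduced_word_ascent[OF w Cons.prems(1)]] .
  thus ?case using Cons.IH[of "xs @ [y]"] Cons.prems(1) by simp
qed

section \<open>Tracking values across the cut after a position\<close>

lemma word_prod_le_iff:
  assumes "k \<notin> set xs"
  shows "word_prod xs p \<le> k \<longleftrightarrow> p \<le> k"
  using assms
proof (induction xs)
  case (Cons x xs)
  \<comment> \<open>A simple transposition other than the one at \<open>k\<close> keeps
    \<open>{0..k}\<close> invariant.\<close>
  have "simple_transposition x q \<le> k \<longleftrightarrow> q \<le> k" for q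
    using Cons.prems by (auto simp: simple_transposition_apply)
  thus ?case using Cons by (simp add: word_prod_Cons)
qed simp

lemma bij_word_prod [simp]: "bij (word_prod xs)"
proof (induction xs)
  case (Cons x xs)
  thus ?case unfolding word_prod_Cons by (intro bij_comp) auto
qed (simp only: word_prod_Nil bij_id)

text \<open>This is the inverse permutation. It allows the values exchanged at one occurrence of a
  letter to be followed while later letters move them around.\<close>

definition position :: "nat list \<Rightarrow> nat \<Rightarrow> nat" where
  "position xs y = inv (word_prod xs) y"

lemma word_prod_position [simp]: "word_prod xs (position xs y) = y"
  unfolding position_def by (simp add: bij_is_surj surj_f_inv_f)

lemma position_word_prod [simp]: "position xs (word_prod xs p) = p"
  unfolding position_def by (simp add: bij_is_inj inv_f_f)

lemma position_eq_iff [simp]: "position xs y = position xs z \<longleftrightarrow> y = z"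
  by (metis word_prod_position)

lemma position_append: "position (xs @ ys) y = position ys (position xs y)"
  by (metis position_word_prod word_prod_position word_prod_append comp_apply)

lemma position_append_le_iff:
  "k \<notin> set ys \<Longrightarrow> position (xs @ ys) y \<le> k \<longleftrightarrow> position xs y \<le> k"
  by (metis position_append word_prod_le_iff word_prod_position)

lemma position_singleton: "position [k] = simple_transposition k"
  by (rule ext) (metis position_word_prod word_prod_Cons word_prod_Nil comp_id simple_transposition_involutory)

text \<open>An inversion given by its values, the larger first, which is the order in which they
  stand.\<close>

definition inverted :: "nat list \<Rightarrow> nat \<Rightarrow> nat \<Rightarrow> bool" where
  "inverted xs y x \<longleftrightarrow> x < y \<and> position xs y < position xs x"

lemma inversion_position: "inverted xs y x \<Longrightarrow> inversion (word_prod xs) (position xs y) (position xs x)"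
  by (simp add: inverted_def inversion_def)

text \<open>Each letter of a reduced word acts at an ascent, so it never exchanges a pair that is
  already inverted.\<close>

lemma inverted_append:
  assumes w: "w permutes {1..n}" and r: "reduced_word n w (xs @ ys @ zs)" and i: "inverted xs y x"
  shows "inverted (xs @ ys) y x"
  using r
proof (induction ys arbitrary: zs rule: rev_induct)
  case Nil
  show ?case using i by simp
next
  case (snoc k ys)
  let ?v = "word_prod (xs @ ys)"
  have inv: "inverted (xs @ ys) y x" using snoc.IH[of "k # zs"] snoc.prems by simp
  have "?v k < ?v (Suc k)" using reduced_word_ascent[OF w, of "xs @ ys" k zs] snoc.prems by simp
  hence "position [k] (position (xs @ ys) y) < position [k] (position (xs @ ys) x)"
    unfolding position_singleton using inv
    by (intro simple_transposition_less) (auto simp: inverted_def dest: arg_cong[of _ _ ?v])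
  thus ?case using inv by (simp add: inverted_def position_append)
qed

text \<open>Below, \<open>x\<^sub>i < y\<^sub>i\<close> are the values exchanged by the \<open>i\<close>-th occurrence of \<open>k\<close>; the words in between
  do not move values across the cut after position \<open>k\<close>, so the set \<open>low4\<close> of values below the cut
  before the third exchange is determined by the first two exchanges.\<close>

lemma forbidden_of_three_occurrences:
  assumes w: "w permutes {1..n}"
    and r: "reduced_word n w (xs @ k # ys @ k # zs @ k # us)"
    and nk: "k \<notin> set xs" "k \<notin> set ys" "k \<notin> set zs"
  shows "forbidden w"
proof -
  let ?v1 = "xs @ [k]"
  let ?v2 = "?v1 @ ys"
  let ?v3 = "?v2 @ [k]"
  let ?v4 = "?v3 @ zs"
  let ?v5 = "?v4 @ [k]"
  define x1 y1 where "x1 = word_prod xs k" and "y1 = word_prod xs (Suc k)"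
  define x2 y2 where "x2 = word_prod ?v2 k" and "y2 = word_prod ?v2 (Suc k)"
  define x3 y3 where "x3 = word_prod ?v4 k" and "y3 = word_prod ?v4 (Suc k)"
  have lt: "x1 < y1" "x2 < y2" "x3 < y3"
    unfolding x1_def y1_def x2_def y2_def x3_def y3_def
    using reduced_word_ascent[OF w, of xs k "ys @ k # zs @ k # us"]
      reduced_word_ascent[OF w, of ?v2 k "zs @ k # us"]
      reduced_word_ascent[OF w, of ?v4 k us] r by simp_all
  have pos: "position xs x1 = k" "position xs y1 = Suc k"
    "position ?v2 x2 = k" "position ?v2 y2 = Suc k"
    "position ?v4 x3 = k" "position ?v4 y3 = Suc k"
    unfolding x1_def y1_def x2_def y2_def x3_def y3_def by (rule position_word_prod)+
  have after: "position (vs @ [k]) z = (if position vs z = k then Suc k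
      else if position vs z = Suc k then k else position vs z)" for vs z
    by (simp add: position_append position_singleton simple_transposition_apply)
  have iff: "position vs z = p \<longleftrightarrow> z = word_prod vs p" for vs z p
    by (metis position_word_prod word_prod_position)
  \<comment> \<open>The exchange brings the value at \<open>Suc k\<close> below the cut and takes
    the value at \<open>k\<close> above it.\<close>
  have low: "position (vs @ [k]) z \<le> k \<longleftrightarrow>
      z = word_prod vs (Suc k) \<or> (z \<noteq> word_prod vs k \<and> position vs z \<le> k)" for vs z
    using inj_eq[OF bij_is_inj[OF bij_word_prod[of vs]], of "Suc k" k]
    unfolding after iff by (auto simp: iff)
  have L0: "position xs z \<le> k \<longleftrightarrow> z \<le> k" for z
    using position_append_le_iff[of k xs "[]"] nk(1) by (simp add: position_def)
  have L2: "position ?v2 z \<le> k \<longleftrightarrow> z = y1 \<or> (z \<noteq> x1 \<and> z \<le> k)" for z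
    using position_append_le_iff[of k ys ?v1 z] nk(2) low[of xs z] L0
    by (simp add: x1_def y1_def)
  have L4: "position ?v4 z \<le> k \<longleftrightarrow> z = y2 \<or> (z \<noteq> x2 \<and> (z = y1 \<or> (z \<noteq> x1 \<and> z \<le> k)))" for z
    using position_append_le_iff[of k zs ?v3 z] nk(3) low[of ?v2 z] L2
    by (simp add: x2_def y2_def)
  define low4 where "low4 z \<longleftrightarrow> z = y2 \<or> (z \<noteq> x2 \<and> (z = y1 \<or> (z \<noteq> x1 \<and> z \<le> k)))" for z
  define J where "J = inverted ?v5"
  have sm: "x1 \<le> k" "\<not> y1 \<le> k" using L0[of x1] L0[of y1] pos by auto
  have m2: "x2 = y1 \<or> x2 \<noteq> x1 \<and> x2 \<le> k" "y2 = x1 \<or> y2 \<noteq> y1 \<and> \<not> y2 \<le> k"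
    using L2[of x2] L2[of y2] pos by auto
  have m3: "low4 x3" "\<not> low4 y3"
    using L4[of x3] L4[of y3] pos by (auto simp: low4_def)
  \<comment> \<open>After the third exchange the values stand as follows: those of
    \<open>low4\<close> except \<open>x3\<close>, then \<open>y3\<close>, then \<open>x3\<close>,
    then all others. The facts \<open>F1\<close> to \<open>F6\<close> read off the inversions this
    guarantees.\<close>
  have p5: "position ?v5 x3 = Suc k" "position ?v5 y3 = k"
    using after[of ?v4 x3] after[of ?v4 y3] pos by auto
  have lo5: "position ?v5 z < k" if "low4 z" "z \<noteq> x3" for z
  proof -
    have "position ?v4 z \<le> k" using that(1) L4[of z] by (simp add: low4_def)
    moreover have "position ?v4 z \<noteq> k"
      using that(2) position_eq_iff[of ?v4 z x3] unfolding pos(5) by blast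
    ultimately show ?thesis using after[of ?v4 z] by auto
  qed
  have hi5: "Suc k < position ?v5 z" if "\<not> low4 z" "z \<noteq> y3" for z
  proof -
    have "\<not> position ?v4 z \<le> k" using that(1) L4[of z] by (simp add: low4_def)
    moreover have "position ?v4 z \<noteq> Suc k"
      using that(2) position_eq_iff[of ?v4 z y3] unfolding pos(6) by blast
    ultimately show ?thesis using after[of ?v4 z] by auto
  qed
  have F1: "J z z'" if "low4 z" "z \<noteq> x3" "\<not> low4 z'" "z' \<noteq> y3" "z' < z" for z z'
    using lo5[of z] hi5[of z'] that by (simp add: J_def inverted_def)
  have F2: "J x3 z'" if "\<not> low4 z'" "z' \<noteq> y3" "z' < x3" for z'
    using hi5[of z'] p5 that by (simp add: J_def inverted_def)
  have F3: "J y3 z'" if "\<not> low4 z'" "z' \<noteq> y3" "z' < y3" for z'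
    using hi5[of z'] p5 that by (simp add: J_def inverted_def)
  have F4: "J z x3" if "low4 z" "z \<noteq> x3" "x3 < z" for z
    using lo5[of z] p5 that by (simp add: J_def inverted_def)
  have F5: "J z y3" if "low4 z" "z \<noteq> x3" "y3 < z" for z
    using lo5[of z] p5 that by (simp add: J_def inverted_def)
  have F6: "J y3 x3" using lt p5 by (simp add: J_def inverted_def)
  have J1: "J y1 x1"
  proof -
    have "inverted ?v1 y1 x1" using lt pos after[of xs x1] after[of xs y1] by (simp add: inverted_def)
    from inverted_append[OF w _ this, of "ys @ [k] @ zs @ [k]" us] r
    show ?thesis by (simp add: J_def)
  qed
  have J2: "J y2 x2"
  proof -
    have "inverted ?v3 y2 x2" using lt pos after[of ?v2 x2] after[of ?v2 y2] by (simp add: inverted_def)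
    from inverted_append[OF w _ this, of "zs @ [k]" us] r
    show ?thesis by (simp add: J_def)
  qed
  \<comment> \<open>Everything to the left of \<open>y3\<close> is in \<open>low4\<close>, and
    everything to the right of \<open>x3\<close> is outside it.\<close>
  have noJ1: "\<not> J z y3" if "\<not> low4 z" for z
    using hi5[OF that] p5 by (cases "z = y3") (auto simp: J_def inverted_def)
  have noJ2: "\<not> J x3 z" if "low4 z" for z
    using lo5[OF that] p5 by (cases "z = x3") (auto simp: J_def inverted_def)
  note inv = inversion_position[of ?v5, folded J_def]
  have X1: "forbidden (word_prod ?v5)" if "J a b" "J b c" "J b d" "c \<noteq> d" for a b c d
    using that(4) inv[OF that(1)] inv[OF that(2)] inv[OF that(3)] position_eq_iff
    unfolding forbidden_def forbidden1_def by blast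
  have X2: "forbidden (word_prod ?v5)" if "J a c" "J b c" "J c d" "a \<noteq> b" for a b c d
    using that(4) inv[OF that(1)] inv[OF that(2)] inv[OF that(3)] position_eq_iff
    unfolding forbidden_def forbidden2_def by blast
  have X3: "forbidden (word_prod ?v5)"
    if "card A = 3" "card B = 3" "\<And>a b. a \<in> A \<Longrightarrow> b \<in> B \<Longrightarrow> J a b" for A B
  proof -
    have "forbidden3 (word_prod ?v5)"
      unfolding forbidden3_def
      using that inv by (intro exI[of _ "position ?v5 ` A"] exI[of _ "position ?v5 ` B"])
        (auto simp: card_image inj_on_def)
    thus ?thesis by (simp add: forbidden_def)
  qed
  have "forbidden (word_prod ?v5)"
  proof (cases "x2 = y1")
    \<comment> \<open>The second exchange sends \<open>y1\<close> back above the cut, so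
      \<open>y2 > y1 > x1\<close> stand in this order. The subcases locate the third pair relative
      to this chain.\<close>
    case x2: True
    with lt sm m2 have y2: "\<not> y2 \<le> k" "y1 < y2" by auto
    have low: "low4 z \<longleftrightarrow> z = y2 \<or> z \<noteq> x1 \<and> z \<le> k" for z
      using x2 y2 sm by (auto simp: low4_def)
    have nl: "\<not> low4 x1" "\<not> low4 y1" "low4 y2" using low sm y2 lt by auto
    show ?thesis
    proof (cases "x3 = y2")
      case True
      thus ?thesis using X1[OF F6 F2[of y1] F2[of x1]] nl y2 lt by auto
    next
      case x3: False
      hence x3': "x3 \<le> k" "x3 \<noteq> x1" using m3 low by auto
      have "y3 \<noteq> x1" using noJ1[OF nl(2)] J1 by auto
      show ?thesis
      proof (cases "y3 = y1")
        case True
        thus ?thesis using X1[OF J2[unfolded x2] _ J1, of x3] F6 x3' by auto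
      next
        case False
        hence "\<not> y3 \<le> k" "y3 \<noteq> y2" using m3 low \<open>y3 \<noteq> x1\<close> by auto
        show ?thesis
        proof (cases "y1 < y3")
          case True
          thus ?thesis using X2[OF J2[unfolded x2] F3[of y1] J1] False nl \<open>y3 \<noteq> y2\<close> by auto
        next
          case ge: False
          hence "J y2 y3" using F5[OF nl(3)] x3 False y2 by auto
          moreover have "J y3 x1" using F3[OF nl(1)] \<open>y3 \<noteq> x1\<close> \<open>\<not> y3 \<le> k\<close> sm by auto
          ultimately show ?thesis using X1[OF _ F6] x3' by blast
        qed
      qed
    qed
  next
    case x2: False
    hence x2': "x2 \<noteq> x1" "x2 \<le> k" using m2 by auto
    show ?thesis
    proof (cases "y2 = x1")
      \<comment> \<open>The mirror image: the second exchange sends \<open>x1\<close> back below the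
        cut, so \<open>y1 > x1 > x2\<close> stand in this order.\<close>
      case y2: True
      have low: "low4 z \<longleftrightarrow> z = y1 \<or> z \<noteq> x2 \<and> z \<le> k" for z
        using x2' sm y2 by (auto simp: low4_def)
      have nl: "low4 x1" "low4 y1" "\<not> low4 x2" using low sm x2 x2' by auto
      have "x3 \<noteq> y1" using noJ2[OF nl(1)] J1 by auto
      hence x3: "x3 \<le> k" "x3 \<noteq> x2" using m3 low by auto
      have J2': "J x1 x2" using J2 y2 by simp
      show ?thesis
      proof (cases "y3 = x2")
        case True
        thus ?thesis using X2[of x1 x2 y1 x3] J2' F6 F5[OF nl(2)] \<open>x3 \<noteq> y1\<close> lt y2 sm by auto
      next
        case y3: False
        hence y3': "\<not> y3 \<le> k" "y3 \<noteq> y1" using m3 low by auto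
        show ?thesis
        proof (cases "x3 = x1")
          case True
          thus ?thesis using X2[OF J1 _ J2', of y3] F6 y3' by auto
        next
          case False
          show ?thesis
          proof (cases "x3 < x1")
            case True
            thus ?thesis using X1[OF J1 F4[OF nl(1)] J2'] x3 by auto
          next
            case ge: False
            have "J y1 x3" using F4[OF nl(2)] \<open>x3 \<noteq> y1\<close> x3 sm by auto
            moreover have "J x3 x2" using F2[OF nl(3)] y3 ge lt y2 by auto
            ultimately show ?thesis using X2[OF _ F6] y3' by blast
          qed
        qed
      qed
    next
      \<comment> \<open>Before the third exchange \<open>y1\<close>, \<open>y2\<close> are now below
        the cut and \<open>x1\<close>, \<open>x2\<close> above it. If the third exchange involves
        none of these four, the three pairs form the six-entry pattern; otherwise a four-entry
        pattern appears.\<close>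
      case False
      hence y2': "y2 \<noteq> y1" "\<not> y2 \<le> k" using m2 by auto
      have low: "low4 z \<longleftrightarrow> z = y1 \<or> z = y2 \<or> z \<noteq> x1 \<and> z \<noteq> x2 \<and> z \<le> k" for z
        using x2' y2' sm by (auto simp: low4_def)
      have nl: "\<not> low4 x1" "\<not> low4 x2" "low4 y1" "low4 y2" using low sm x2 x2' y2' by auto
      show ?thesis
      proof (cases "x3 \<le> k")
        case x3: True
        hence x3': "x3 \<noteq> y1" "x3 \<noteq> y2" "x3 \<noteq> x1" "x3 \<noteq> x2" using m3 nl sm y2' by auto
        show ?thesis
        proof (cases "y3 \<le> k")
          case True
          have "J y1 y3" "J y2 y3" using F5[OF nl(3)] F5[OF nl(4)] x3' sm y2' True by auto
          thus ?thesis using X2[OF _ _ F6] y2'(1) by blast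
        next
          case y3: False
          hence y3': "y3 \<noteq> y1" "y3 \<noteq> y2" "y3 \<noteq> x1" "y3 \<noteq> x2" using m3 nl sm x2' by auto
          have "J y1 x2" "J y2 x1" using F1 nl x3' y3' sm x2' y2' by auto
          moreover have "J y3 x1" "J y3 x2" using F3 nl y3 y3' sm x2' by auto
          moreover have "J y1 x3" "J y2 x3" using F4 nl x3 x3' sm y2' by auto
          ultimately have "J a b" if "a \<in> {y1, y2, y3}" "b \<in> {x1, x2, x3}" for a b
            using that J1 J2 F6 by auto
          moreover have "card {y1, y2, y3} = 3" "card {x1, x2, x3} = 3"
            using y3' y2' x3' x2' by auto
          ultimately show ?thesis using X3 by blast
        qed
      next
        case x3: False
        have "x1 < x3" "x2 < x3" "x1 \<noteq> y3" "x2 \<noteq> y3" using x3 sm x2' lt by auto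
        thus ?thesis using X1[OF F6 F2[OF nl(1)] F2[OF nl(2)]] x2' by auto
      qed
    qed
  qed
  moreover have "reduced_word n w (?v5 @ us)" using r by simp
  ultimately show ?thesis using forbidden_reduced_word_append[OF w] by blast
qed

lemma split_three_occurrences:
  assumes "2 < count_list xs k"
  shows "\<exists>as bs cs ds. xs = as @ k # bs @ k # cs @ k # ds \<and> k \<notin> set as \<and> k \<notin> set bs \<and> k \<notin> set cs"
proof -
  have split: "\<exists>as bs. ys = as @ k # bs \<and> k \<notin> set as \<and> count_list bs k = count_list ys k - 1"
    if "0 < count_list ys k" for ys
  proof -
    have "k \<in> set ys" using that by (metis count_list_0_iff less_irrefl)
    then obtain as bs where "ys = as @ k # bs" "k \<notin> set as" by (metis split_list_first)
    moreover have "count_list as k = 0" using \<open>k \<notin> set as\<close> by (simp add: count_list_0_iff)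
    ultimately show ?thesis by (intro exI[of _ as] exI[of _ bs]) simp
  qed
  obtain as bs where 1: "xs = as @ k # bs" "k \<notin> set as" "count_list bs k = count_list xs k - 1"
    using split[of xs] assms by auto
  obtain bs' cs where 2: "bs = bs' @ k # cs" "k \<notin> set bs'" "count_list cs k = count_list bs k - 1"
    using split[of bs] 1(3) assms by auto
  obtain cs' ds where 3: "cs = cs' @ k # ds" "k \<notin> set cs'"
    using split[of cs] 2(3) 1(3) assms by auto
  show ?thesis using 1 2 3 by auto
qed

subsection \<open>A pattern yields three occurrences of a generator\<close>

lemma descent_between:
  assumes "inversion w a b"
  shows "\<exists>i. a \<le> i \<and> i < b \<and> w (Suc i) < (w i :: nat)"
proof (rule ccontr)
  assume neg: "\<not> ?thesis"
  have "w a \<le> w c" if "a \<le> c" "c \<le> b" for c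
    using that
  proof (induction c rule: dec_induct)
    case (step i)
    hence "w i \<le> w (Suc i)" using neg by (metis Suc_le_lessD linorder_not_le)
    thus ?case using step by simp
  qed simp
  from this[of b] show False using assms by (simp add: inversion_def)
qed

lemma mono_between:
  assumes "a \<le> b" "\<And>i. a \<le> i \<Longrightarrow> i < b \<Longrightarrow> \<not> w (Suc i) < (w i :: nat)"
  shows "w a \<le> w b"
proof (rule ccontr)
  assume "\<not> ?thesis"
  hence "inversion w a b" using assms(1) by (cases "a = b") (auto simp: inversion_def)
  thus False using descent_between assms(2) by blast
qed

abbreviation repetitive :: "nat \<Rightarrow> (nat \<Rightarrow> nat) \<Rightarrow> bool" where
  "repetitive n w \<equiv> \<exists>xs i. reduced_word n w xs \<and> 2 < count_list xs i"

lemma repetitive_descending: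
  assumes "w permutes {1..n}" "set js \<subseteq> {1..<n}" "descending w js" "2 < count_list js k"
  shows "repetitive n w"
proof -
  obtain xs where "reduced_word n w (xs @ rev js)"
    using reduced_word_descending[OF assms(1-3)] by blast
  moreover have "2 < count_list (xs @ rev js) k" using assms(4) by simp
  ultimately show ?thesis by blast
qed

text \<open>Undoing the listed descents exchanges only larger values with smaller ones, or either with
  the middle value, so the order inside the two outer groups of the pattern is irrelevant.\<close>

lemma repetitive_consecutive1:
  assumes w: "w permutes {1..n}"
    and i: "inversion w p (p + 1)" "inversion w (p + 1) (p + 2)" "inversion w (p + 1) (p + 3)"
  shows "repetitive n w"
proof (rule repetitive_descending[OF w])
  show "set [p + 1, p, p + 1, p + 2, p + 1] \<subseteq> {1..<n}"
    using inversion_in_range[OF w i(1)] inversion_in_range[OF w i(3)] by simp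
  show "descending w [p + 1, p, p + 1, p + 2, p + 1]"
    using i by (simp add: inversion_def simple_transposition_apply numeral_eq_Suc)
  show "2 < count_list [p + 1, p, p + 1, p + 2, p + 1] (p + 1)" by simp
qed

lemma repetitive_consecutive2:
  assumes w: "w permutes {1..n}"
    and i: "inversion w p (p + 2)" "inversion w (p + 1) (p + 2)" "inversion w (p + 2) (p + 3)"
  shows "repetitive n w"
proof (rule repetitive_descending[OF w])
  show "set [p + 1, p + 2, p + 1, p, p + 1] \<subseteq> {1..<n}"
    using inversion_in_range[OF w i(1)] inversion_in_range[OF w i(3)] by simp
  show "descending w [p + 1, p + 2, p + 1, p, p + 1]"
    using i by (simp add: inversion_def simple_transposition_apply numeral_eq_Suc)
  show "2 < count_list [p + 1, p + 2, p + 1, p, p + 1] (p + 1)" by simp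
qed

lemma repetitive_consecutive3:
  assumes w: "w permutes {1..n}"
    and i: "\<And>a b. a \<in> {p, p + 1, p + 2} \<Longrightarrow> b \<in> {p + 3, p + 4, p + 5} \<Longrightarrow> inversion w a b"
  shows "repetitive n w"
proof (rule repetitive_descending[OF w])
  \<comment> \<open>Moving three entries past three others takes nine exchanges. They form a diamond
    with rows of 1, 2, 3, 2, 1 letters; the middle position \<open>p + 2\<close> occurs in the
    first, third and fifth row.\<close>
  let ?js = "[p + 2, p + 1, p + 3, p, p + 4, p + 2, p + 1, p + 3, p + 2]"
  have lt: "w b < w a" if "a \<in> {p, p + 1, p + 2}" "b \<in> {p + 3, p + 4, p + 5}" for a b
    using i[OF that] by (simp add: inversion_def)
  show "set ?js \<subseteq> {1..<n}"
    using inversion_in_range[OF w i[of p "p + 5"]] by simp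
  show "descending w ?js"
    using lt[of p "p + 3"] lt[of p "p + 4"] lt[of p "p + 5"]
      lt[of "p + 1" "p + 3"] lt[of "p + 1" "p + 4"] lt[of "p + 1" "p + 5"]
      lt[of "p + 2" "p + 3"] lt[of "p + 2" "p + 4"] lt[of "p + 2" "p + 5"]
    by (simp add: simple_transposition_apply numeral_eq_Suc)
  show "2 < count_list ?js (p + 2)" by simp
qed

section \<open>Permutations where undoing any descent destroys the pattern\<close>

lemma card_3_less:
  assumes "card (A :: nat set) = 3"
  obtains a b c where "A = {a, b, c}" "a < b" "b < c"
proof -
  have fin: "finite A" using assms by (metis card.infinite zero_neq_numeral)
  define xs where "xs = sorted_list_of_set A"
  have "length xs = 3" "sorted_wrt (<) xs" "set xs = A" using assms fin by (simp_all add: xs_def)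
  then obtain a b c where "xs = [a, b, c]"
    by (auto simp: numeral_eq_Suc length_Suc_conv)
  thus ?thesis using that \<open>sorted_wrt (<) xs\<close> \<open>set xs = A\<close> by auto
qed

text \<open>Every descent must be an inversion of the chosen pattern, since undoing any other one
  would merely move the pattern. Hence \<open>a\<close>, \<open>b\<close>, \<open>c\<close> are
  consecutive, and from \<open>Suc c\<close> to \<open>d\<close> the entries rise, so that
  \<open>Suc c\<close> can replace \<open>d\<close>.\<close>

lemma repetitive_minimal1:
  assumes w: "w permutes {1..n}" and f: "forbidden1 w"
    and min: "\<And>i. w (Suc i) < w i \<Longrightarrow> \<not> forbidden1 (swap w i)"
  shows "repetitive n w"
proof -
  obtain a b c d where o: "c < d" and I: "inversion w a b" "inversion w b c" "inversion w b d"
    using f unfolding forbidden1_def by (metis nat_neq_iff)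
  have D: "(i = a \<and> b = Suc i) \<or> (i = b \<and> c = Suc i)" if "w (Suc i) < w i" for i
  proof (rule ccontr)
    let ?s = "simple_transposition i"
    assume neg: "\<not> ?thesis"
    have "b < c" using I by (simp add: inversion_def)
    hence "(a, b) \<noteq> (i, Suc i)" "(b, c) \<noteq> (i, Suc i)" "(b, d) \<noteq> (i, Suc i)" using neg o by auto
    note inversion_swap_descent[OF I(1) this(1)] inversion_swap_descent[OF I(2) this(2)]
      inversion_swap_descent[OF I(3) this(3)]
    moreover have "?s c \<noteq> ?s d" using o by simp
    ultimately show False using min[OF that] unfolding forbidden1_def by blast
  qed
  have ab: "b = Suc a" using descent_between[OF I(1)] D I by (auto simp: inversion_def)
  have bc: "c = Suc b" using descent_between[OF I(2)] D I by (fastforce simp: inversion_def)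
  have "w (Suc c) \<le> w d" 
  proof (rule mono_between[of "Suc c" d w])
    show "\<not> w (Suc i) < w i" if "Suc c \<le> i" "i < d" for i using D[of i] that ab bc by auto
  qed (use o in simp)
  hence "inversion w b (Suc c)" using I bc by (simp add: inversion_def)
  thus ?thesis using repetitive_consecutive1[OF w, of a] I ab bc by (simp add: numeral_eq_Suc)
qed

text \<open>The mirror image of the previous argument: \<open>b\<close>, \<open>c\<close>,
  \<open>d\<close> are consecutive, and the entries rise from \<open>a\<close> to the position just
  before \<open>b\<close>, which can replace \<open>a\<close>.\<close>

lemma repetitive_minimal2:
  assumes w: "w permutes {1..n}" and f: "forbidden2 w"
    and min: "\<And>i. w (Suc i) < w i \<Longrightarrow> \<not> forbidden2 (swap w i)"
  shows "repetitive n w"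
proof -
  obtain a b c d where o: "a < b" and I: "inversion w a c" "inversion w b c" "inversion w c d"
    using f unfolding forbidden2_def by (metis nat_neq_iff)
  have D: "(i = b \<and> c = Suc i) \<or> (i = c \<and> d = Suc i)" if "w (Suc i) < w i" for i
  proof (rule ccontr)
    let ?s = "simple_transposition i"
    assume neg: "\<not> ?thesis"
    have "b < c" using I by (simp add: inversion_def)
    hence "(a, c) \<noteq> (i, Suc i)" "(b, c) \<noteq> (i, Suc i)" "(c, d) \<noteq> (i, Suc i)" using neg o by auto
    note inversion_swap_descent[OF I(1) this(1)] inversion_swap_descent[OF I(2) this(2)]
      inversion_swap_descent[OF I(3) this(3)]
    moreover have "?s a \<noteq> ?s b" using o by simp
    ultimately show False using min[OF that] unfolding forbidden2_def by blast
  qed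
  have bc: "c = Suc b" using descent_between[OF I(2)] D I by (auto simp: inversion_def)
  have cd: "d = Suc c" using descent_between[OF I(3)] D I by (fastforce simp: inversion_def)
  obtain b' where b': "b = Suc b'" using o by (cases b) auto
  have "w a \<le> w b'" 
  proof (rule mono_between[of a b' w])
    show "\<not> w (Suc i) < w i" if "a \<le> i" "i < b'" for i using D[of i] that b' bc cd by auto
  qed (use o b' in simp)
  hence "inversion w b' c" using I bc b' by (simp add: inversion_def)
  thus ?thesis using repetitive_consecutive2[OF w, of b'] I b' bc cd by (simp add: numeral_eq_Suc)
qed

text \<open>Every descent leads from \<open>A\<close> to \<open>B\<close>. As \<open>A\<close> lies
  entirely before \<open>B\<close>, the only descent is at the largest element of \<open>A\<close>.
  Elsewhere the entries rise, so \<open>A\<close> and \<open>B\<close> can be replaced by the three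
  positions on either side of this descent.\<close>

lemma repetitive_minimal3:
  assumes w: "w permutes {1..n}" and f: "forbidden3 w"
    and min: "\<And>i. w (Suc i) < w i \<Longrightarrow> \<not> forbidden3 (swap w i)"
  shows "repetitive n w"
proof -
  obtain A B where AB: "card A = 3" "card B = 3" and I: "\<And>a b. a \<in> A \<Longrightarrow> b \<in> B \<Longrightarrow> inversion w a b"
    using f unfolding forbidden3_def by blast
  have D: "i \<in> A \<and> Suc i \<in> B" if "w (Suc i) < w i" for i
  proof (rule ccontr)
    let ?s = "simple_transposition i"
    assume "\<not> ?thesis"
    hence inv: "inversion (swap w i) (?s a) (?s b)" if "a \<in> A" "b \<in> B" for a b
      using inversion_swap_descent[OF I[OF that], of i] that by blast
    have "\<forall>a\<in>?s ` A. \<forall>b\<in>?s ` B. inversion (swap w i) a b" using inv by blast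
    moreover have "card (?s ` A) = 3" "card (?s ` B) = 3"
      using AB by (simp_all add: card_image inj_on_def)
    ultimately show False using min[OF that] unfolding forbidden3_def by blast
  qed
  obtain a b c where A: "A = {a, b, c}" "a < b" "b < c" using card_3_less[OF AB(1)] .
  obtain d e f where B: "B = {d, e, f}" "d < e" "e < f" using card_3_less[OF AB(2)] .
  have "c < d" using I[of c d] A B by (simp add: inversion_def)
  have cd: "d = Suc c" "\<And>i. w (Suc i) < w i \<Longrightarrow> i = c"
  proof -
    obtain i where "c \<le> i" "i < d" "w (Suc i) < w i"
      using descent_between[OF I[of c d]] A B by auto
    moreover have "j \<le> c \<and> d \<le> Suc j" if "w (Suc j) < w j" for j
      using D[OF that] A B by auto
    ultimately show "d = Suc c" "\<And>i. w (Suc i) < w i \<Longrightarrow> i = c" by force+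
  qed
  \<comment> \<open>The truncated subtraction is exact because \<open>a < b < c\<close>.\<close>
  define p where "p = c - 2"
  have p: "c = p + 2" "a \<le> p" using A by (auto simp: p_def)
  have hi: "w a \<le> w x" if "x \<in> {p, p + 1, p + 2}" for x

  proof (rule mono_between[of a x w])
    show "\<not> w (Suc i) < w i" if "a \<le> i" "i < x" for i
      using cd(2)[of i] that \<open>x \<in> _\<close> p by auto
  qed (use that p in auto)
  have lo: "w y \<le> w f" if "y \<in> {p + 3, p + 4, p + 5}" for y

  proof (rule mono_between[of y f w])
    show "\<not> w (Suc i) < w i" if "y \<le> i" "i < f" for i
      using cd(2)[of i] that \<open>y \<in> _\<close> p by auto
  qed (use that p cd B in auto)
  have "w f < w a" using I[of a f] A B by (simp add: inversion_def)
  hence "inversion w x y" if "x \<in> {p, p + 1, p + 2}" "y \<in> {p + 3, p + 4, p + 5}" for x y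
    using hi[OF that(1)] lo[OF that(2)] that by (auto simp: inversion_def)
  thus ?thesis by (rule repetitive_consecutive3[OF w])
qed

text \<open>Descents are undone while some pattern survives, and their letters are appended again
  afterwards. Where this stops, whichever pattern is present satisfies its own minimality
  condition.\<close>

lemma forbidden_repetitive:
  assumes "w permutes {1..n}" "forbidden w"
  shows "repetitive n w"
  using assms
proof (induction "card (inversions w)" arbitrary: w rule: less_induct)
  case less
  note w = less.prems(1)
  show ?case
  proof (cases "\<exists>i. w (Suc i) < w i \<and> forbidden (swap w i)")
    case True
    then obtain i where i: "w (Suc i) < w i" "forbidden (swap w i)" by blast
    have "inversion w i (Suc i)" using i by (simp add: inversion_def)
    hence r: "i \<in> {1..<n}" using inversion_in_range[OF w] by force
    obtain xs k where xs: "reduced_word n (swap w i) xs" "2 < count_list xs k"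
      using less.hyps[OF _ swap_permutes[OF w r] i(2)] card_inversions_swap_descent[OF w r i(1)] by auto
    have "2 < count_list (xs @ [i]) k" using xs(2) by simp
    thus ?thesis using reduced_word_snoc[OF w r i(1) xs(1)] by blast
  next
    case False
    thus ?thesis
      using less.prems repetitive_minimal1[OF w] repetitive_minimal2[OF w] repetitive_minimal3[OF w]
      unfolding forbidden_def by blast
  qed
qed

lemma two_boolean_iff:
  "two_boolean n w \<longleftrightarrow> w permutes {1..n} \<and> \<not> forbidden w"
proof (cases "w permutes {1..n}")
  case w: True
  have "forbidden w" if "reduced_word n w xs" "2 < count_list xs k" for xs k
    using split_three_occurrences[OF that(2)] forbidden_of_three_occurrences[OF w] that(1) by blast
  thus ?thesis using w forbidden_repetitive[OF w] unfolding two_boolean_def by auto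
qed (simp add: two_boolean_def)

subsection \<open>Pattern avoidance in terms of crossings\<close>

text \<open>The entries that cross the cut after \<open>m\<close> upwards. The value 0 is included
  because it will mark an image not yet chosen, which lies outside the square seen so far.\<close>

definition crossing :: "(nat \<Rightarrow> nat) \<Rightarrow> nat \<Rightarrow> nat set" where
  "crossing w m = {p \<in> {1..m}. w p = 0 \<or> m < w p}"

text \<open>A position \<^term>\<open>p \<in> {1..k}\<close> with \<^term>\<open>w p = 0\<close> is one whose image has not been chosen yet,
  so an admissible function is the restriction of a permutation to the pairs
  \<^term>\<open>(i, w i)\<close> in the square \<^term>\<open>{1..k} \<times> {1..k}\<close>.\<close>

definition partial_permutation :: "nat \<Rightarrow> (nat \<Rightarrow> nat) \<Rightarrow> bool" where
  "partial_permutation k w \<longleftrightarrow>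
     (\<forall>i. i \<notin> {1..k} \<longrightarrow> w i = i) \<and> (\<forall>i \<in> {1..k}. w i \<le> k) \<and>
     (\<forall>i j. w i = w j \<longrightarrow> w i \<noteq> 0 \<longrightarrow> i = j)"

text \<open>The second conjunct makes excedance values increase and lets no open position precede an
  excedance already filled. The third expresses the increase of deficiency values by requiring
  smaller values to be used earlier, which can be checked inside the square.\<close>

definition admissible :: "nat \<Rightarrow> (nat \<Rightarrow> nat) \<Rightarrow> bool" where
  "admissible k w \<longleftrightarrow> partial_permutation k w \<and>
     (\<forall>i j. 1 \<le> i \<longrightarrow> i < j \<longrightarrow> j < w j \<longrightarrow> 0 < w i \<and> w i < w j) \<and>
     (\<forall>i u. w i < i \<longrightarrow> 1 \<le> u \<longrightarrow> u < w i \<longrightarrow> (\<exists>h<i. w h = u)) \<and>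
     (\<forall>m \<in> {1..k}. card (crossing w m) \<le> 2) \<and>
     (\<forall>m \<in> {1..k}. w m = m \<longrightarrow> card (crossing w m) \<le> 1)"

lemma partial_permutationD:
  assumes "partial_permutation k w"
  shows "i \<notin> {1..k} \<Longrightarrow> w i = i" "i \<in> {1..k} \<Longrightarrow> w i \<le> k"
    "w i = w j \<Longrightarrow> w i \<noteq> 0 \<Longrightarrow> i = j"
  using assms unfolding partial_permutation_def by blast+

lemma finite_crossing [simp]: "finite (crossing w m)"
  by (simp add: crossing_def)

text \<open>There are \<open>m\<close> positions and \<open>m\<close> values in
  \<open>{1..m}\<close>. Removing from both counts the entries of \<open>?B\<close>, whose position
  and value are at most \<open>m\<close>, leaves the upward and the downward crossings.\<close>

lemma card_crossing_dual:
  assumes w: "w permutes {1..n}" and m: "m \<le> n"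
  shows "card {p \<in> {1..n}. m < p \<and> w p \<le> m} = card (crossing w m)"
proof -
  let ?B = "{p \<in> {1..m}. w p \<le> m}"
  have pos: "w p \<noteq> 0" if "p \<in> {1..m}" for p
    using permutes_in_image[OF w, of p] that m by auto
  have eq: "{p \<in> {1..n}. w p \<le> m} = {1..n} \<inter> w -` {1..m}"
    using permutes_in_image[OF w] by force
  have "w ` ({1..n} \<inter> w -` {1..m}) = {1..m}"
  proof
    show "{1..m} \<subseteq> w ` ({1..n} \<inter> w -` {1..m})"
    proof
      fix y assume y: "y \<in> {1..m}"
      then obtain p where "p \<in> {1..n}" "w p = y"
        using permutes_image[OF w] m by (metis atLeastAtMost_iff image_iff le_trans)
      thus "y \<in> w ` ({1..n} \<inter> w -` {1..m})" using y by blast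
    qed
  qed auto
  hence "m = card {p \<in> {1..n}. w p \<le> m}"
    using card_image[OF permutes_inj_on[OF w], of "{1..n} \<inter> w -` {1..m}"] eq by simp
  also have "{p \<in> {1..n}. w p \<le> m} = ?B \<union> {p \<in> {1..n}. m < p \<and> w p \<le> m}"
    using m by auto
  also have "card \<dots> = card ?B + card {p \<in> {1..n}. m < p \<and> w p \<le> m}"
    by (rule card_Un_disjoint) auto
  finally have dual: "m = card ?B + card {p \<in> {1..n}. m < p \<and> w p \<le> m}" .
  have "m = card {1..m}" by simp
  also have "{1..m} = ?B \<union> crossing w m"
    by (auto simp: crossing_def)
  also have "card \<dots> = card ?B + card (crossing w m)"
  proof (rule card_Un_disjoint)
    show "?B \<inter> crossing w m = {}" using pos by (force simp: crossing_def)
  qed auto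
  finally show ?thesis using dual by linarith
qed

lemma card_ge_2_iff:
  assumes "finite S"
  shows "2 \<le> card S \<longleftrightarrow> (\<exists>a b. a \<in> S \<and> b \<in> S \<and> a \<noteq> b)"
proof
  assume "2 \<le> card S"
  then obtain T where "T \<subseteq> S" "card T = 2" by (metis obtain_subset_with_card_n)
  thus "\<exists>a b. a \<in> S \<and> b \<in> S \<and> a \<noteq> b" by (auto simp: card_2_iff)
next
  assume "\<exists>a b. a \<in> S \<and> b \<in> S \<and> a \<noteq> b"
  then obtain a b where "{a, b} \<subseteq> S" "a \<noteq> b" by blast
  thus "2 \<le> card S" using card_mono[OF assms, of "{a, b}"] by simp
qed

lemma card_ge_2I: "finite S \<Longrightarrow> a \<in> S \<Longrightarrow> b \<in> S \<Longrightarrow> a \<noteq> b \<Longrightarrow> 2 \<le> card S"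
  using card_ge_2_iff by blast

text \<open>In a four-entry pattern the middle entry can be neither an excedance, being below an
  earlier entry, nor a deficiency, being above a later one. So it is a fixed point, and two entries
  cross the cut there. The six-entry pattern makes three entries cross one cut.\<close>

lemma admissible_not_forbidden:
  assumes w: "w permutes {1..n}" and adm: "admissible n w"
  shows "\<not> forbidden w"
proof -
  have E: "w i < w j" if "1 \<le> i" "i < j" "j < w j" for i j
    using adm that unfolding admissible_def by blast
  have D: "w i < w j" if ij: "1 \<le> i" "i < j" "w i < i" for i j
  proof (rule ccontr)
    assume "\<not> ?thesis"
    moreover have "w i \<noteq> w j" using ij inj_eq[OF permutes_inj[OF w]] by simp
    moreover have "1 \<le> w j"
      using permutes_in_image[OF w, of j] permutes_not_in[OF w, of j] that by (cases "j \<in> {1..n}") auto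
    ultimately have "1 \<le> w j" "w j < w i" by auto
    then obtain h where "h < i" "w h = w j"
      using adm ij(3) unfolding admissible_def by blast
    thus False using that inj_eq[OF permutes_inj[OF w]] by auto
  qed
  have R: "card (crossing w m) \<le> 2" "w m = m \<Longrightarrow> card (crossing w m) < 2" if "m \<in> {1..n}" for m
    using adm that unfolding admissible_def by force+
  note dual = card_crossing_dual[OF w]
  note range = inversion_in_range[OF w]
  have "\<not> forbidden1 w"
  proof
    assume "forbidden1 w"
    then obtain a b c d where cd: "c \<noteq> d" and I: "inversion w a b" "inversion w b c" "inversion w b d"
      unfolding forbidden1_def by blast
    note r = range[OF I(1)] range[OF I(2)] range[OF I(3)]
    have wb: "w b = b" using E[of a b] D[of b c] I r by (force simp: inversion_def)
    hence "2 \<le> card {p \<in> {1..n}. b < p \<and> w p \<le> b}"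
      using cd I r by (intro card_ge_2I[of _ c d]) (auto simp: inversion_def)
    thus False using dual[of b] R(2)[of b] wb r by simp
  qed
  moreover have "\<not> forbidden2 w"
  proof
    assume "forbidden2 w"
    then obtain a b c d where ab: "a \<noteq> b" and I: "inversion w a c" "inversion w b c" "inversion w c d"
      unfolding forbidden2_def by blast
    note r = range[OF I(1)] range[OF I(2)] range[OF I(3)]
    have wc: "w c = c" using E[of a c] D[of c d] I r by (force simp: inversion_def)
    hence "2 \<le> card (crossing w c)"
      using ab I r by (intro card_ge_2I[of _ a b]) (auto simp: crossing_def inversion_def)
    thus False using R(2)[of c] wc r by simp
  qed
  moreover have "\<not> forbidden3 w"
  proof
    assume "forbidden3 w"
    then obtain A B where AB: "card A = 3" "card B = 3" and I: "\<And>a b. a \<in> A \<Longrightarrow> b \<in> B \<Longrightarrow> inversion w a b"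
      unfolding forbidden3_def by blast
    have fin: "finite A" "finite B" "A \<noteq> {}" "B \<noteq> {}" using AB by (auto intro: card_ge_0_finite)
    \<comment> \<open>If \<open>M \<le> c\<close>, all of \<open>B\<close> crosses the cut after
      \<open>c\<close> downwards; otherwise all of \<open>A\<close> crosses the cut after
      \<open>M\<close> upwards.\<close>
    define c M where "c = Max A" and "M = Max (w ` B)"
    have cM: "c \<in> A" "M \<in> w ` B" "\<And>a. a \<in> A \<Longrightarrow> a \<le> c" "\<And>b. b \<in> B \<Longrightarrow> w b \<le> M"
      using fin by (auto simp: c_def M_def)
    have r: "1 \<le> a" "a < b" "b \<le> n" "w b < w a" if "a \<in> A" "b \<in> B" for a b
      using range[OF I[OF that]] I[OF that] by (auto simp: inversion_def)
    obtain b0 where b0: "b0 \<in> B" "M = w b0" using cM by blast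
    have cr: "c \<in> {1..n}" using r[OF cM(1) b0(1)] by auto
    have Mr: "M \<in> {1..n}" using permutes_in_image[OF w, of b0] b0 r[OF cM(1) b0(1)] by auto
    show False
    proof (cases "M \<le> c")
      case True
      have "B \<subseteq> {p \<in> {1..n}. c < p \<and> w p \<le> c}"
      proof
        fix b assume b: "b \<in> B"
        thus "b \<in> {p \<in> {1..n}. c < p \<and> w p \<le> c}"
          using r[OF cM(1) b] cM(4)[OF b] True by simp
      qed
      from card_mono[OF _ this] show False using AB dual[of c] R(1)[OF cr] cr by simp
    next
      case False
      have "A \<subseteq> crossing w M"
      proof
        fix a assume a: "a \<in> A"
        thus "a \<in> crossing w M"
          using r[OF a b0(1)] cM(3)[OF a] False b0 by (simp add: crossing_def)
      qed
      from card_mono[OF _ this] show False using AB R(1)[OF Mr] by simp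
    qed
  qed
  ultimately show ?thesis by (simp add: forbidden_def)
qed

text \<open>A violated condition yields entries crossing a cut in one direction; by
  \<open>card_crossing_dual\<close> as many cross it in the other direction, and these complete a
  pattern.\<close>

lemma not_forbidden_admissible:
  assumes w: "w permutes {1..n}" and nf: "\<not> forbidden w"
  shows "admissible n w"
proof -
  note dual = card_crossing_dual[OF w]
  have pos: "1 \<le> w i" if "1 \<le> i" for i
    using permutes_in_image[OF w, of i] permutes_not_in[OF w, of i] that by (cases "i \<in> {1..n}") auto
  have n1: "\<not> (c \<noteq> d \<and> inversion w a b \<and> inversion w b c \<and> inversion w b d)" for a b c d
    using nf unfolding forbidden_def forbidden1_def by blast
  have n2: "\<not> (a \<noteq> b \<and> inversion w a c \<and> inversion w b c \<and> inversion w c d)" for a b c d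
    using nf unfolding forbidden_def forbidden2_def by blast
  have P: "partial_permutation n w"
    unfolding partial_permutation_def
  proof (intro conjI ballI allI impI)
    show "w i \<le> n" if "i \<in> {1..n}" for i using permutes_in_image[OF w, of i] that by simp
  qed (use permutes_not_in[OF w] inj_eq[OF permutes_inj[OF w]] in auto)
  have E: "0 < w i \<and> w i < w j" if ij: "1 \<le> i" "i < j" "j < w j" for i j
  proof (rule ccontr)
    assume "\<not> ?thesis"
    moreover have "w i \<noteq> w j" using ij inj_eq[OF permutes_inj[OF w]] by simp
    ultimately have lt: "w j < w i" using pos[OF ij(1)] by linarith
    have jn: "j \<in> {1..n}" using permutes_not_in[OF w, of j] ij by auto
    have "2 \<le> card (crossing w j)"
      using ij lt by (intro card_ge_2I[of _ i j]) (auto simp: crossing_def)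
    hence "2 \<le> card {p \<in> {1..n}. j < p \<and> w p \<le> j}" using dual[of j] jn by simp
    then obtain c d where "c \<noteq> d" "j < c" "w c \<le> j" "j < d" "w d \<le> j"
      by (subst (asm) card_ge_2_iff) auto
    thus False using n1[of c d i j] lt ij by (simp add: inversion_def)
  qed
  have D: "\<exists>h<i. w h = u" if iu: "w i < i" "1 \<le> u" "u < w i" for i u
  proof (rule ccontr)
    assume neg: "\<not> ?thesis"
    obtain h where h: "w h = u" using permutes_surj[OF w] by (metis surj_def)
    have ih: "i < h" using neg h iu by (metis linorder_neqE_nat less_irrefl)
    have ir: "i \<in> {1..n}" using permutes_not_in[OF w, of i] iu by auto
    have hr: "h \<in> {1..n}" using permutes_not_in[OF w, of h] ih h iu by auto
    \<comment> \<open>The cut is taken just before \<open>i\<close>, so that the deficiency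
      \<open>i\<close> itself crosses it downwards together with \<open>h\<close>; the two upward
      crossings then lie left of \<open>i\<close> and above \<open>w i\<close>.\<close>
    have "2 \<le> card {p \<in> {1..n}. i - 1 < p \<and> w p \<le> i - 1}"
      using iu ih h ir hr by (intro card_ge_2I[of _ i h]) auto
    moreover have "i - 1 \<le> n" using ir unfolding atLeastAtMost_iff by linarith
    ultimately have "2 \<le> card (crossing w (i - 1))" using dual[of "i - 1"] by metis
    then obtain a b where ab: "a \<noteq> b" "a \<in> crossing w (i - 1)" "b \<in> crossing w (i - 1)"
      by (subst (asm) card_ge_2_iff) auto
    have "inversion w x i" if "x \<in> crossing w (i - 1)" for x
      using that iu pos[of x] by (auto simp: crossing_def inversion_def)
    thus False using n2[of a b i h] ab ih h iu by (simp add: inversion_def)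
  qed
  have R: "card (crossing w m) \<le> 2" if m: "m \<in> {1..n}" for m
  proof (rule ccontr)
    assume "\<not> ?thesis"
    hence "3 \<le> card (crossing w m)" "3 \<le> card {p \<in> {1..n}. m < p \<and> w p \<le> m}"
      using dual[of m] m by auto
    moreover obtain A where "A \<subseteq> crossing w m" "card A = 3"
      using obtain_subset_with_card_n[OF calculation(1)] by blast
    moreover obtain B where "B \<subseteq> {p \<in> {1..n}. m < p \<and> w p \<le> m}" "card B = 3"
      using obtain_subset_with_card_n[OF calculation(2)] by blast
    moreover have "inversion w a b"
      if "a \<in> crossing w m" "b \<in> {p \<in> {1..n}. m < p \<and> w p \<le> m}" for a b
      using that pos[of a] by (auto simp: crossing_def inversion_def)
    ultimately have "forbidden3 w" unfolding forbidden3_def by (meson subsetD)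
    thus False using nf by (simp add: forbidden_def)
  qed
  have F: "card (crossing w m) \<le> 1" if m: "m \<in> {1..n}" "w m = m" for m
  proof (rule ccontr)
    assume "\<not> ?thesis"
    hence c: "2 \<le> card (crossing w m)" "2 \<le> card {p \<in> {1..n}. m < p \<and> w p \<le> m}"
      using dual[of m] m by auto
    obtain a where "a \<in> crossing w m" using c(1) by (subst (asm) card_ge_2_iff) auto
    hence "inversion w a m" using m pos[of a]
      by (cases "a = m") (auto simp: crossing_def inversion_def)
    moreover obtain p q where pq: "p \<noteq> q" "m < p" "w p \<le> m" "m < q" "w q \<le> m"
      using c(2) by (subst (asm) card_ge_2_iff) auto
    moreover have "w p \<noteq> w m" "w q \<noteq> w m" using pq inj_eq[OF permutes_inj[OF w]] by auto
    ultimately show False using n1[of p q a m] m by (simp add: inversion_def)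
  qed
  show ?thesis unfolding admissible_def using P E D R F by blast
qed

lemma partial_permutation_permutes:
  assumes "partial_permutation n w" "crossing w n = {}"
  shows "w permutes {1..n}"
proof (rule bij_imp_permutes)
  have pos: "w i \<noteq> 0" if "i \<in> {1..n}" for i using assms(2) that by (auto simp: crossing_def)
  have inj: "inj_on w {1..n}"
    using partial_permutationD(3)[OF assms(1)] pos unfolding inj_on_def by blast
  have "w ` {1..n} \<subseteq> {1..n}"
  proof
    fix y assume "y \<in> w ` {1..n}"
    then obtain i where "i \<in> {1..n}" "y = w i" by blast
    thus "y \<in> {1..n}" 
      using partial_permutationD(2)[OF assms(1), of i] pos[of i] by simp
  qed
  thus "bij_betw w {1..n} {1..n}"
    using inj endo_inj_surj[of "{1..n}" w] by (simp add: bij_betw_def)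
  show "w x = x" if "x \<notin> {1..n}" for x
    using partial_permutationD(1)[OF assms(1) that] .
qed

lemma two_boolean_iff_admissible:
  "two_boolean n w \<longleftrightarrow> admissible n w \<and> card (crossing w n) = 0"
proof
  assume "two_boolean n w"
  hence w: "w permutes {1..n}" "admissible n w"
    using not_forbidden_admissible by (auto simp: two_boolean_iff)
  have "w p \<in> {1..n}" if "p \<in> {1..n}" for p using permutes_in_image[OF w(1)] that by simp
  hence "crossing w n = {}" by (fastforce simp: crossing_def)
  thus "admissible n w \<and> card (crossing w n) = 0" using w by simp
next
  assume a: "admissible n w \<and> card (crossing w n) = 0"
  hence "w permutes {1..n}"
    by (intro partial_permutation_permutes) (auto simp: admissible_def)
  thus "two_boolean n w" using a admissible_not_forbidden by (simp add: two_boolean_iff)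
qed

subsection \<open>Counting by restriction to growing squares\<close>

text \<open>Undoes one growth of the square: the position holding \<open>Suc k\<close> becomes open
  again, and position \<open>Suc k\<close> gets its own value, as for every position outside the
  square.\<close>

definition restriction :: "nat \<Rightarrow> (nat \<Rightarrow> nat) \<Rightarrow> nat \<Rightarrow> nat" where
  "restriction k w i = (if i = Suc k then Suc k else if w i = Suc k then 0 else w i)"

lemma crossing_restriction: "m \<le> k \<Longrightarrow> crossing (restriction k w) m = crossing w m"
  by (auto simp: crossing_def restriction_def)

lemma partial_permutation_restriction:
  assumes "partial_permutation (Suc k) w"
  shows "partial_permutation k (restriction k w)"
  unfolding partial_permutation_def
proof (intro conjI allI ballI impI)
  note P = partial_permutationD[OF assms]
  show "restriction k w i = i" if "i \<notin> {1..k}" for i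
    using P(1)[of i] that by (cases "i = Suc k") (auto simp: restriction_def)
  show "restriction k w i \<le> k" if "i \<in> {1..k}" for i
    using P(2)[of i] that by (auto simp: restriction_def le_Suc_eq)
  show "i = j" if eq: "restriction k w i = restriction k w j" "restriction k w i \<noteq> 0" for i j
    using P(3)[of i j] eq by (auto simp: restriction_def split: if_splits)
qed

lemma admissible_Suc_iff:
  assumes P: "partial_permutation (Suc k) w"
  shows "admissible (Suc k) w \<longleftrightarrow> admissible k (restriction k w) \<and>
     (\<forall>i p. 1 \<le> i \<longrightarrow> i < p \<longrightarrow> p \<le> k \<longrightarrow> w p = Suc k \<longrightarrow> 0 < w i) \<and>
     (\<forall>u. w (Suc k) \<le> k \<longrightarrow> 1 \<le> u \<longrightarrow> u < w (Suc k) \<longrightarrow> (\<exists>h\<le>k. w h = u)) \<and>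
     card (crossing w (Suc k)) \<le> 2 \<and>
     (w (Suc k) = Suc k \<longrightarrow> card (crossing w (Suc k)) \<le> 1)" (is "?L \<longleftrightarrow> ?R")
proof
  let ?u = "restriction k w"
  assume L: ?L
  have E: "0 < w i \<and> w i < w j" if "1 \<le> i" "i < j" "j < w j" for i j
    using L that unfolding admissible_def by blast
  have D: "\<exists>h<i. w h = u" if "w i < i" "1 \<le> u" "u < w i" for i u
    using L that unfolding admissible_def by blast
  have R: "card (crossing w m) \<le> 2" "w m = m \<Longrightarrow> card (crossing w m) \<le> 1" if "m \<in> {1..Suc k}" for m
    using L that unfolding admissible_def by blast+
  have "admissible k ?u"
    unfolding admissible_def
  proof (intro conjI allI ballI impI)
    show "partial_permutation k ?u" by (rule partial_permutation_restriction[OF P])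
    fix i j assume ij: "1 \<le> i" "i < j" "j < ?u j"
    hence "?u j = w j" by (auto simp: restriction_def split: if_splits)
    moreover from this have jk: "j \<le> k" "w j \<le> k"
      using partial_permutationD(1,2)[OF partial_permutation_restriction[OF P], of j] ij
      by (cases "j \<in> {1..k}"; auto)+
    moreover have "0 < w i" "w i < w j" using E[of i j] ij calculation by auto
    moreover from this have "?u i = w i" using jk ij by (auto simp: restriction_def)
    ultimately show "0 < ?u i" "?u i < ?u j" by simp_all
  next
    fix i u assume iu: "?u i < i" "1 \<le> u" "u < ?u i"
    hence "?u i = w i" by (auto simp: restriction_def split: if_splits)
    then obtain h where h: "h < i" "w h = u" using D[of i u] iu by auto
    have ik: "i \<le> k" "?u i \<le> k"
      using partial_permutationD(1,2)[OF partial_permutation_restriction[OF P], of i] iu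
      by (cases "i \<in> {1..k}"; auto)+
    hence "?u h = u" using h iu by (auto simp: restriction_def)
    thus "\<exists>h<i. ?u h = u" using h by blast
  next
    fix m assume m: "m \<in> {1..k}"
    show "card (crossing ?u m) \<le> 2" using R(1)[of m] m by (simp add: crossing_restriction)
    assume "?u m = m"
    hence "w m = m" using m by (auto simp: restriction_def split: if_splits)
    thus "card (crossing ?u m) \<le> 1" using R(2)[of m] m by (simp add: crossing_restriction)
  qed
  moreover have "0 < w i" if "1 \<le> i" "i < p" "p \<le> k" "w p = Suc k" for i p
    using E[of i p] that by simp
  moreover have "\<exists>h\<le>k. w h = u" if "w (Suc k) \<le> k" "1 \<le> u" "u < w (Suc k)" for u
    using D[of "Suc k" u] that by (auto simp: less_Suc_eq_le)
  ultimately show ?R using R[of "Suc k"] by auto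
next
  let ?u = "restriction k w"
  note P' = partial_permutationD[OF P]
  assume R: ?R
  hence adm: "admissible k ?u" by blast
  have E: "0 < ?u i \<and> ?u i < ?u j" if "1 \<le> i" "i < j" "j < ?u j" for i j
    using adm that unfolding admissible_def by blast
  have D: "\<exists>h<i. ?u h = u" if "?u i < i" "1 \<le> u" "u < ?u i" for i u
    using adm that unfolding admissible_def by blast
  have R': "card (crossing w m) \<le> 2" "w m = m \<Longrightarrow> card (crossing w m) \<le> 1" if m: "m \<in> {1..k}" for m
  proof -
    have "card (crossing ?u m) \<le> 2" "?u m = m \<Longrightarrow> card (crossing ?u m) \<le> 1"
      using adm m unfolding admissible_def by blast+
    moreover have "w m = m \<Longrightarrow> ?u m = m" using m by (simp add: restriction_def)
    ultimately show "card (crossing w m) \<le> 2" "w m = m \<Longrightarrow> card (crossing w m) \<le> 1"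
      using m by (simp_all add: crossing_restriction)
  qed
  show ?L
    unfolding admissible_def
  proof (intro conjI allI ballI impI)
    show "partial_permutation (Suc k) w" by (rule P)
    fix i j assume ij: "1 \<le> i" "i < j" "j < w j"
    have jk: "j \<le> k" using P'(1)[of j] P'(2)[of j] ij by (cases "j \<in> {1..Suc k}") auto
    have "0 < w i \<and> w i < w j"
    proof (cases "w j = Suc k")
      case True
      have "0 < w i" using R ij jk True by blast
      moreover have "w i \<noteq> Suc k" using P'(3)[of i j] True ij by auto
      ultimately show ?thesis using True P'(2)[of i] ij jk by auto
    next
      case False
      hence u: "?u j = w j" using jk by (simp add: restriction_def)
      hence "0 < ?u i \<and> ?u i < ?u j" using E[of i j] ij by simp
      moreover from this have "?u i = w i" using jk ij by (auto simp: restriction_def split: if_splits)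
      ultimately show ?thesis using u by simp
    qed
    thus "0 < w i" "w i < w j" by auto
  next
    fix i u assume iu: "w i < i" "1 \<le> u" "u < w i"
    have ik: "i \<le> Suc k" using P'(1)[of i] iu by (cases "i \<in> {1..Suc k}") auto
    show "\<exists>h<i. w h = u"
    proof (cases "i = Suc k")
      case True
      hence "\<exists>h\<le>k. w h = u" using R iu by auto
      thus ?thesis using True by (auto simp: less_Suc_eq_le)
    next
      case False
      hence "?u i = w i" using ik iu by (simp add: restriction_def)
      then obtain h where "h < i" "?u h = u" using D[of i u] iu by auto
      moreover from this have "w h = u" using iu ik False by (auto simp: restriction_def split: if_splits)
      ultimately show ?thesis by blast
    qed
  next
    fix m assume m: "m \<in> {1..Suc k}"
    show "card (crossing w m) \<le> 2" using R R'(1)[of m] m by (cases "m = Suc k") auto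
    show "card (crossing w m) \<le> 1" if "w m = m" using R R'(2)[of m] m that by (cases "m = Suc k") auto
  qed
qed

section \<open>The five ways of growing the square by one\<close>

abbreviation first_open :: "nat \<Rightarrow> (nat \<Rightarrow> nat) \<Rightarrow> nat" where
  "first_open k u \<equiv> Min (crossing u k)"

definition unused :: "nat \<Rightarrow> (nat \<Rightarrow> nat) \<Rightarrow> nat set" where
  "unused k u = {1..k} - u ` {1..k}"

abbreviation first_unused :: "nat \<Rightarrow> (nat \<Rightarrow> nat) \<Rightarrow> nat" where
  "first_unused k u \<equiv> Min (unused k u)"

lemma crossing_self:
  assumes "partial_permutation k u"
  shows "crossing u k = {p \<in> {1..k}. u p = 0}"
  using partial_permutationD(2)[OF assms] by (force simp: crossing_def)

text \<open>Filled positions map injectively into \<open>{1..k}\<close>, so as many values as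
  positions are left over.\<close>

lemma card_unused:
  assumes P: "partial_permutation k u"
  shows "card (unused k u) = card (crossing u k)"
proof -
  note P' = partial_permutationD[OF P]
  let ?A = "{1..k} - crossing u k"
  have "inj_on u ?A"
    using P'(3) unfolding crossing_self[OF P] inj_on_def by blast
  moreover have A: "u ` ?A \<subseteq> {1..k}"
  proof
    fix y assume "y \<in> u ` ?A"
    then obtain i where "i \<in> {1..k}" "u i \<noteq> 0" "y = u i" unfolding crossing_self[OF P] by blast
    thus "y \<in> {1..k}" using P'(2)[of i] by simp
  qed
  moreover have "unused k u = {1..k} - u ` ?A"
    unfolding unused_def crossing_self[OF P] by auto
  moreover have "card ?A = k - card (crossing u k)"
    by (subst card_Diff_subset) (auto simp: crossing_def)
  moreover have "card (crossing u k) \<le> k"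
  proof -
    have "crossing u k \<subseteq> {1..k}" by (auto simp: crossing_def)
    from card_mono[OF _ this] show ?thesis by simp
  qed
  ultimately show ?thesis by (simp add: card_Diff_subset card_image)
qed

text \<open>The step that makes \<^term>\<open>Suc k\<close> a fixed point needs no definition: functions on the square of
  size \<open>k\<close> already fix \<^term>\<open>Suc k\<close>.\<close>

definition open_step :: "nat \<Rightarrow> (nat \<Rightarrow> nat) \<Rightarrow> nat \<Rightarrow> nat" where
  "open_step k u = u(Suc k := 0)"
definition value_step :: "nat \<Rightarrow> (nat \<Rightarrow> nat) \<Rightarrow> nat \<Rightarrow> nat" where
  "value_step k u = u(Suc k := first_unused k u)"
definition position_step :: "nat \<Rightarrow> (nat \<Rightarrow> nat) \<Rightarrow> nat \<Rightarrow> nat" where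
  "position_step k u = u(first_open k u := Suc k, Suc k := 0)"
definition close_step :: "nat \<Rightarrow> (nat \<Rightarrow> nat) \<Rightarrow> nat \<Rightarrow> nat" where
  "close_step k u = u(first_open k u := Suc k, Suc k := first_unused k u)"

lemma first_open:
  assumes P: "partial_permutation k u" and c: "0 < card (crossing u k)"
  shows "first_open k u \<in> {1..k}" "u (first_open k u) = 0"
    "1 \<le> i \<Longrightarrow> i < first_open k u \<Longrightarrow> 0 < u i"
proof -
  have "crossing u k \<noteq> {}" using c by auto
  hence m: "first_open k u \<in> crossing u k" by simp
  thus p: "first_open k u \<in> {1..k}" "u (first_open k u) = 0" by (auto simp: crossing_self[OF P])
  show "0 < u i" if "1 \<le> i" "i < first_open k u"
  proof (rule ccontr)
    assume "\<not> 0 < u i"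
    hence "i \<in> crossing u k" using that p(1) by (simp add: crossing_self[OF P])
    thus False using that(2) by (metis Min_le finite_crossing linorder_not_le)
  qed
qed

lemma first_unused:
  assumes P: "partial_permutation k u" and c: "0 < card (crossing u k)"
  shows "first_unused k u \<in> {1..k}" "u i \<noteq> first_unused k u"
    "1 \<le> v \<Longrightarrow> v < first_unused k u \<Longrightarrow> \<exists>h\<le>k. u h = v"
proof -
  have fin: "finite (unused k u)" by (simp add: unused_def)
  have "unused k u \<noteq> {}" using c card_unused[OF P] by auto
  hence m: "first_unused k u \<in> unused k u" using fin by simp
  thus p: "first_unused k u \<in> {1..k}" by (simp add: unused_def)
  show "u i \<noteq> first_unused k u"
  proof
    assume eq: "u i = first_unused k u"
    hence "i \<in> {1..k}" using p partial_permutationD(1)[OF P, of i] by metis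
    hence "u i \<notin> unused k u" by (simp add: unused_def)
    thus False using m eq by simp
  qed
  show "\<exists>h\<le>k. u h = v" if "1 \<le> v" "v < first_unused k u"
  proof (rule ccontr)
    assume "\<not> ?thesis"
    hence "v \<in> unused k u" using that p by (auto simp: unused_def)
    thus False using that(2) fin by (metis Min_le linorder_not_le)
  qed
qed

lemma partial_permutation_mono:
  assumes "partial_permutation k u"
  shows "partial_permutation (Suc k) u"
  unfolding partial_permutation_def
proof (intro conjI allI ballI impI)
  note P = partial_permutationD[OF assms]
  show "u i = i" if "i \<notin> {1..Suc k}" for i using P(1)[of i] that by force
  show "u i \<le> Suc k" if "i \<in> {1..Suc k}" for i
    using P(1)[of i] P(2)[of i] that by (cases "i = Suc k") auto
  show "i = j" if "u i = u j" "u i \<noteq> 0" for i j using P(3) that by blast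
qed

lemma partial_permutation_update_last:
  assumes P: "partial_permutation (Suc k) u" and v: "v \<le> Suc k" "v = 0 \<or> (\<forall>i. i \<noteq> Suc k \<longrightarrow> u i \<noteq> v)"
  shows "partial_permutation (Suc k) (u(Suc k := v))"
  unfolding partial_permutation_def
proof (intro conjI allI ballI impI)
  note P' = partial_permutationD[OF P]
  let ?w = "u(Suc k := v)"
  show "?w i = i" if "i \<notin> {1..Suc k}" for i using P'(1)[of i] that by auto
  show "?w i \<le> Suc k" if "i \<in> {1..Suc k}" for i using P'(2)[of i] that v(1) by auto
  show "i = j" if "?w i = ?w j" "?w i \<noteq> 0" for i j
    using P'(3)[of i j] that v(2) by (auto split: if_splits)
qed

lemma partial_permutation_position_step:
  assumes P: "partial_permutation k u" and c: "0 < card (crossing u k)"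
  shows "partial_permutation (Suc k) (position_step k u)"
  unfolding partial_permutation_def
proof (intro conjI allI ballI impI)
  note P' = partial_permutationD[OF P]
  note f = first_open[OF P c]
  let ?w = "position_step k u"
  show "?w i = i" if "i \<notin> {1..Suc k}" for i
    using P'(1)[of i] that f(1) by (auto simp: position_step_def)
  show "?w i \<le> Suc k" if "i \<in> {1..Suc k}" for i
    using P'(2)[of i] that by (auto simp: position_step_def)
  have ne: "u i \<noteq> Suc k" if "i \<noteq> Suc k" for i
    using P'(1)[of i] P'(2)[of i] that by (cases "i \<in> {1..k}") auto
  show "i = j" if "?w i = ?w j" "?w i \<noteq> 0" for i j
    using P'(3)[of i j] that ne[of i] ne[of j] by (auto simp: position_step_def split: if_splits)
qed

lemma close_step_eq: "close_step k u = (position_step k u)(Suc k := first_unused k u)"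
  by (simp add: close_step_def position_step_def)

lemma partial_permutation_steps:
  assumes P: "partial_permutation k u"
  shows "partial_permutation (Suc k) (open_step k u)"
    and "0 < card (crossing u k) \<Longrightarrow> partial_permutation (Suc k) (value_step k u)"
    and "0 < card (crossing u k) \<Longrightarrow> partial_permutation (Suc k) (close_step k u)"
proof -
  note P1 = partial_permutation_mono[OF P]
  show "partial_permutation (Suc k) (open_step k u)"
    unfolding open_step_def by (rule partial_permutation_update_last[OF P1]) auto
  assume c: "0 < card (crossing u k)"
  note f = first_unused[OF P c]
  show "partial_permutation (Suc k) (value_step k u)"
    unfolding value_step_def by (rule partial_permutation_update_last[OF P1]) (use f in auto)
  show "partial_permutation (Suc k) (close_step k u)"
    unfolding close_step_eq
    by (rule partial_permutation_update_last[OF partial_permutation_position_step[OF P c]])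
      (use f in \<open>auto simp: position_step_def\<close>)
qed

lemma restriction_steps:
  assumes P: "partial_permutation k u"
  shows "restriction k (open_step k u) = u" "restriction k u = u"
    and "0 < card (crossing u k) \<Longrightarrow> restriction k (value_step k u) = u"
    and "0 < card (crossing u k) \<Longrightarrow> restriction k (position_step k u) = u"
    and "0 < card (crossing u k) \<Longrightarrow> restriction k (close_step k u) = u"
proof -
  note P' = partial_permutationD[OF P]
  have ne: "u i \<noteq> Suc k" if "i \<noteq> Suc k" for i
    using P'(1)[of i] P'(2)[of i] that by (cases "i \<in> {1..k}") auto
  have last: "u (Suc k) = Suc k" using P'(1)[of "Suc k"] by simp
  note f = first_open(1,2)[OF P]
  show "restriction k (open_step k u) = u" "restriction k u = u"
    and "0 < card (crossing u k) \<Longrightarrow> restriction k (value_step k u) = u"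
    and "0 < card (crossing u k) \<Longrightarrow> restriction k (position_step k u) = u"
    and "0 < card (crossing u k) \<Longrightarrow> restriction k (close_step k u) = u"
    using ne last f
    by (auto simp: fun_eq_iff restriction_def open_step_def value_step_def position_step_def close_step_def)
qed

lemma crossing_steps:
  assumes P: "partial_permutation k u"
  shows "crossing (open_step k u) (Suc k) = insert (Suc k) (crossing u k)"
    and "crossing u (Suc k) = crossing u k"
    and "0 < card (crossing u k) \<Longrightarrow> crossing (value_step k u) (Suc k) = crossing u k"
    and "0 < card (crossing u k) \<Longrightarrow>
      crossing (position_step k u) (Suc k) = insert (Suc k) (crossing u k - {first_open k u})"
    and "0 < card (crossing u k) \<Longrightarrow>
      crossing (close_step k u) (Suc k) = crossing u k - {first_open k u}"
proof -
  note P' = partial_permutationD[OF P]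
  have le: "\<not> Suc k < u i" "\<not> k < u i" if "1 \<le> i" "i \<le> k" for i
    using P'(2)[of i] that by auto
  have last: "u (Suc k) = Suc k" using P'(1)[of "Suc k"] by simp
  note f = first_open(1)[OF P] first_unused(1)[OF P]
  show "crossing (open_step k u) (Suc k) = insert (Suc k) (crossing u k)"
    unfolding open_step_def using le by (auto simp: crossing_def le_Suc_eq)
  show "crossing u (Suc k) = crossing u k"
    using le last by (auto simp: crossing_def le_Suc_eq)
  assume c: "0 < card (crossing u k)"
  show "crossing (value_step k u) (Suc k) = crossing u k"
    unfolding value_step_def using le f[OF c] by (auto simp: crossing_def le_Suc_eq)
  show "crossing (position_step k u) (Suc k) = insert (Suc k) (crossing u k - {first_open k u})"
    unfolding position_step_def using le f[OF c] by (auto simp: crossing_def le_Suc_eq)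
  show "crossing (close_step k u) (Suc k) = crossing u k - {first_open k u}"
    unfolding close_step_def using le f[OF c] by (auto simp: crossing_def le_Suc_eq)
qed

lemma admissible_partial_permutation: "admissible k w \<Longrightarrow> partial_permutation k w"
  by (simp add: admissible_def)

lemma card_crossing_le_2: "admissible k w \<Longrightarrow> card (crossing w k) \<le> 2"
  by (cases "k = 0") (auto simp: admissible_def crossing_def)

lemma card_crossing_steps:
  assumes P: "partial_permutation k u"
  shows "card (crossing (open_step k u) (Suc k)) = Suc (card (crossing u k))"
    and "card (crossing u (Suc k)) = card (crossing u k)"
    and "0 < card (crossing u k) \<Longrightarrow> card (crossing (value_step k u) (Suc k)) = card (crossing u k)"
    and "0 < card (crossing u k) \<Longrightarrow> card (crossing (position_step k u) (Suc k)) = card (crossing u k)"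
    and "0 < card (crossing u k) \<Longrightarrow> card (crossing (close_step k u) (Suc k)) = card (crossing u k) - 1"
proof -
  have last: "Suc k \<notin> crossing u k" by (simp add: crossing_def)
  show "card (crossing (open_step k u) (Suc k)) = Suc (card (crossing u k))"
    "card (crossing u (Suc k)) = card (crossing u k)"
    using last by (simp_all add: crossing_steps[OF P])
  assume c: "0 < card (crossing u k)"
  hence "crossing u k \<noteq> {}" by auto
  hence m: "first_open k u \<in> crossing u k" by simp
  show "card (crossing (value_step k u) (Suc k)) = card (crossing u k)"
    by (simp add: crossing_steps(3)[OF P c])
  show "card (crossing (position_step k u) (Suc k)) = card (crossing u k)"
    using last m c by (simp add: crossing_steps(4)[OF P c])
  show "card (crossing (close_step k u) (Suc k)) = card (crossing u k) - 1"
    using m by (simp add: crossing_steps(5)[OF P c])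
qed

text \<open>Opening adds a crossing to at most two, and a fixed point tolerates only one; hence the
  bounds in the first two cases. In the others the minimality of \<open>first_open\<close> and
  \<open>first_unused\<close> provides the first-in, first-out conditions.\<close>

lemma admissible_steps:
  assumes adm: "admissible k u"
  shows "card (crossing u k) \<le> 1 \<Longrightarrow> admissible (Suc k) (open_step k u)"
    and "card (crossing u k) \<le> 1 \<Longrightarrow> admissible (Suc k) u"
    and "0 < card (crossing u k) \<Longrightarrow> admissible (Suc k) (value_step k u)"
    and "0 < card (crossing u k) \<Longrightarrow> admissible (Suc k) (position_step k u)"
    and "0 < card (crossing u k) \<Longrightarrow> admissible (Suc k) (close_step k u)"
proof -
  note P = admissible_partial_permutation[OF adm]
  note P' = partial_permutationD[OF P]
  note le = card_crossing_le_2[OF adm]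
  note R = restriction_steps[OF P] and C = card_crossing_steps[OF P] and S = partial_permutation_steps[OF P]
  have ne: "u i \<noteq> Suc k" if "i \<le> k" for i
    using P'(1)[of i] P'(2)[of i] that by (cases "i \<in> {1..k}") auto
  have last: "u (Suc k) = Suc k" using P'(1)[of "Suc k"] by simp
  show "admissible (Suc k) (open_step k u)" if "card (crossing u k) \<le> 1"
    unfolding admissible_Suc_iff[OF S(1)] R C using adm that ne by (auto simp: open_step_def)
  show "admissible (Suc k) u" if "card (crossing u k) \<le> 1"
    unfolding admissible_Suc_iff[OF partial_permutation_mono[OF P]] R C using adm that ne last by auto
  assume c: "0 < card (crossing u k)"
  note f = first_open[OF P c] first_unused[OF P c]
  show "admissible (Suc k) (value_step k u)"
    unfolding admissible_Suc_iff[OF S(2)[OF c]] R(3)[OF c] C(3)[OF c]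
  proof (intro conjI allI impI)
    show "0 < value_step k u i" if "1 \<le> i" "i < p" "p \<le> k" "value_step k u p = Suc k" for i p
      using that ne[of p] by (simp add: value_step_def)
    show "\<exists>h\<le>k. value_step k u h = v" if v: "1 \<le> v" "v < value_step k u (Suc k)" for v
    proof -
      obtain h where "h \<le> k" "u h = v" using f(6)[of v] v by (auto simp: value_step_def)
      thus ?thesis by (intro exI[of _ h]) (simp add: value_step_def)
    qed
    show "card (crossing u k) \<le> 1" if "value_step k u (Suc k) = Suc k"
      using that f(4) by (simp add: value_step_def)
  qed (use adm le in auto)
  show "admissible (Suc k) (position_step k u)"
    unfolding admissible_Suc_iff[OF partial_permutation_position_step[OF P c]] R(4)[OF c] C(4)[OF c]
  proof (intro conjI allI impI)
    fix i p assume "1 \<le> i" "i < p" "p \<le> k" "position_step k u p = Suc k"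
    thus "0 < position_step k u i"
      using ne[of p] f(3)[of i] by (auto simp: position_step_def split: if_splits)
  next
    show "card (crossing u k) \<le> 2" by (rule le)
  qed (use adm in \<open>auto simp: position_step_def\<close>)
  show "admissible (Suc k) (close_step k u)"
    unfolding admissible_Suc_iff[OF S(3)[OF c]] R(5)[OF c] C(5)[OF c]
  proof (intro conjI allI impI)
    fix i p assume "1 \<le> i" "i < p" "p \<le> k" "close_step k u p = Suc k"
    thus "0 < close_step k u i" using ne[of p] f(3)[of i] by (auto simp: close_step_def split: if_splits)
  next
    fix v assume v: "1 \<le> v" "v < close_step k u (Suc k)"
    obtain h where h: "h \<le> k" "u h = v" using f(6)[of v] v by (auto simp: close_step_def)
    have "h \<noteq> first_open k u" using f(2) h(2) v(1) by fastforce
    thus "\<exists>h\<le>k. close_step k u h = v" using h by (intro exI[of _ h]) (simp add: close_step_def)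
  next
    show "card (crossing u k) - 1 \<le> 2" "card (crossing u k) - 1 \<le> 1" using le by auto
  qed (rule adm)
qed

text \<open>Two choices determine \<open>w\<close>: whether position \<open>Suc k\<close> stays
  open, is fixed or takes an old value, and whether the value \<open>Suc k\<close> goes to an old
  position. First in, first out leaves only one candidate for the old value and for the old
  position.\<close>

lemma admissible_Suc_cases:
  assumes adm: "admissible (Suc k) w"
  defines "u \<equiv> restriction k w"
  shows "admissible k u \<and>
    (card (crossing u k) \<le> 1 \<and> w = open_step k u \<or> card (crossing u k) \<le> 1 \<and> w = u \<or>
     0 < card (crossing u k) \<and> (w = value_step k u \<or> w = position_step k u \<or> w = close_step k u))"
proof -
  note P = admissible_partial_permutation[OF adm]
  note P' = partial_permutationD[OF P]
  note A = iffD1[OF admissible_Suc_iff[OF P] adm, folded u_def]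
  have admu: "admissible k u" using A by blast
  note Pu = admissible_partial_permutation[OF admu]
  have u: "u i = (if i = Suc k then Suc k else if w i = Suc k then 0 else w i)" for i
    by (simp add: u_def restriction_def)
  have first: "p = first_open k u" "0 < card (crossing u k)" if p: "p \<in> {1..k}" "w p = Suc k" for p
  proof -
    have pc: "p \<in> crossing u k" using p by (simp add: crossing_self[OF Pu] u)
    thus c: "0 < card (crossing u k)" by (metis card_gt_0_iff empty_iff finite_crossing)
    \<comment> \<open>An open position before \<open>p\<close> would have to be filled in
      \<open>w\<close>, but the only value it could have gained is \<open>Suc k\<close>, which is at
      \<open>p\<close>.\<close>
    have "\<not> first_open k u < p"
    proof
      assume lt: "first_open k u < p"
      note f = first_open(1,2)[OF Pu c]
      have "0 < w (first_open k u)" using A f(1) lt p by auto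
      hence "w (first_open k u) = Suc k" using f u[of "first_open k u"] by (auto split: if_splits)
      thus False using P'(3)[of "first_open k u" p] p lt by simp
    qed
    moreover have "first_open k u \<le> p" using pc by simp
    ultimately show "p = first_open k u" by simp
  qed
  have last: "w (Suc k) = first_unused k u \<and> 0 < card (crossing u k)"
    if w: "w (Suc k) \<noteq> 0" "w (Suc k) \<noteq> Suc k"
  proof -
    have le: "w (Suc k) \<in> {1..k}" using P'(2)[of "Suc k"] w by auto
    moreover have "w (Suc k) \<notin> u ` {1..k}"
    proof
      assume "w (Suc k) \<in> u ` {1..k}"
      then obtain h where "h \<in> {1..k}" "w (Suc k) = u h" by blast
      thus False using P'(3)[of "Suc k" h] w u[of h] by (auto split: if_splits)
    qed
    ultimately have m: "w (Suc k) \<in> unused k u" by (simp add: unused_def)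
    hence c: "0 < card (crossing u k)"
      unfolding card_unused[OF Pu, symmetric] by (auto simp: card_gt_0_iff unused_def)
    have "\<not> first_unused k u < w (Suc k)"
    proof
      assume lt: "first_unused k u < w (Suc k)"
      note f = first_unused(1,2)[OF Pu c]
      obtain h where h: "h \<le> k" "w h = first_unused k u" using A f(1) lt le by auto
      moreover have "w h \<noteq> Suc k" using h f(1) by auto
      ultimately show False using f(2)[of h] u[of h] by auto
    qed
    moreover have "first_unused k u \<le> w (Suc k)" using m by (simp add: unused_def)
    ultimately show ?thesis using c by simp
  qed
  have fix_range: "i \<in> {1..k}" if "w i = Suc k" "i \<noteq> Suc k" for i
    using P'(1)[of i] that by (cases "i \<in> {1..Suc k}") (auto simp: le_Suc_eq)
  show ?thesis
  proof (cases "\<exists>p \<in> {1..k}. w p = Suc k")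
    case True
    then obtain p where p: "p \<in> {1..k}" "w p = Suc k" by blast
    have rest: "w i = u i" if "i \<noteq> Suc k" "i \<noteq> p" for i
      using u[of i] P'(3)[of i p] p that by auto
    have n: "w (Suc k) \<noteq> Suc k" using P'(3)[of "Suc k" p] p by auto
    show ?thesis
    proof (cases "w (Suc k) = 0")
      case True
      hence "w = position_step k u"
        unfolding position_step_def first(1)[OF p, symmetric] using rest p by (auto simp: fun_eq_iff)
      thus ?thesis using admu first(2)[OF p] by blast
    next
      case False
      hence "w = close_step k u"
        unfolding close_step_def first(1)[OF p, symmetric] using rest p last n by (auto simp: fun_eq_iff)
      thus ?thesis using admu first(2)[OF p] by blast
    qed
  next
    case False
    have rest: "w i = u i" if "i \<noteq> Suc k" for i
    proof -
      have "w i \<noteq> Suc k" using False fix_range[of i] that by blast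
      thus ?thesis using u[of i] that by simp
    qed
    consider "w (Suc k) = 0" | "w (Suc k) = Suc k" | "w (Suc k) \<noteq> 0" "w (Suc k) \<noteq> Suc k" by blast
    thus ?thesis
    proof cases
      case 1
      hence w: "w = open_step k u" using rest by (auto simp: open_step_def fun_eq_iff)
      have "card (crossing u k) \<le> 1"
        using A card_crossing_steps(1)[OF Pu] unfolding w by simp
      thus ?thesis using admu w by blast
    next
      case 2
      have w: "w = u"
      proof
        show "w i = u i" for i using rest[of i] u[of "Suc k"] 2 by (cases "i = Suc k") simp_all
      qed
      have "card (crossing u k) \<le> 1"
        using A 2 card_crossing_steps(2)[OF Pu] by (simp add: w[symmetric])
      thus ?thesis using admu w by blast
    next
      case 3
      hence "w = value_step k u" using rest last by (auto simp: value_step_def fun_eq_iff)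
      thus ?thesis using admu last[OF 3] by blast
    qed
  qed
qed

section \<open>The three-state transfer matrix\<close>

definition admissibles :: "nat \<Rightarrow> nat \<Rightarrow> (nat \<Rightarrow> nat) set" where
  "admissibles k j = {w. admissible k w \<and> card (crossing w k) = j}"

text \<open>Opening adds a crossing, closing removes one, and the other three steps keep the number.
  With no crossing there is nothing to fill; with two, neither opening nor a fixed point is
  possible.\<close>

lemma admissibles_Suc:
  "admissibles (Suc k) 0 = admissibles k 0 \<union> close_step k ` admissibles k 1"
  "admissibles (Suc k) 1 = open_step k ` admissibles k 0 \<union> admissibles k 1 \<union>
     value_step k ` admissibles k 1 \<union> position_step k ` admissibles k 1 \<union>
     close_step k ` admissibles k 2"
  "admissibles (Suc k) 2 = open_step k ` admissibles k 1 \<union>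
     value_step k ` admissibles k 2 \<union> position_step k ` admissibles k 2"
proof -
  have sub: "w \<in> (if j = 0 then {} else open_step k ` admissibles k (j - 1)) \<union>
       (if j \<le> 1 then admissibles k j else {}) \<union>
       (if j = 0 then {} else value_step k ` admissibles k j \<union> position_step k ` admissibles k j) \<union>
       close_step k ` admissibles k (Suc j)"
    if w: "w \<in> admissibles (Suc k) j" for w j
  proof -
    let ?u = "restriction k w"
    have a: "admissible (Suc k) w" "card (crossing w (Suc k)) = j"
      using w by (auto simp: admissibles_def)
    note c = admissible_Suc_cases[OF a(1)]
    have adm: "admissible k ?u" using c by blast
    note C = card_crossing_steps[OF admissible_partial_permutation[OF adm]]
    from c consider "card (crossing ?u k) \<le> 1" "w = open_step k ?u"
      | "card (crossing ?u k) \<le> 1" "w = ?u"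
      | "0 < card (crossing ?u k)" "w = value_step k ?u"
      | "0 < card (crossing ?u k)" "w = position_step k ?u"
      | "0 < card (crossing ?u k)" "w = close_step k ?u" by satx
    thus ?thesis
    proof cases
      case 1
      hence "Suc (card (crossing ?u k)) = j" using C(1) a(2) by metis
      hence "?u \<in> admissibles k (j - 1)" "j \<noteq> 0" using adm by (auto simp: admissibles_def)
      thus ?thesis using 1 by auto
    next
      case 2
      hence "card (crossing ?u k) = j" using C(2) a(2) by metis
      hence "?u \<in> admissibles k j" "j \<le> 1" using adm 2 by (auto simp: admissibles_def)
      thus ?thesis using 2 by auto
    next
      case 3
      hence "card (crossing ?u k) = j" using C(3) a(2) by metis
      hence "?u \<in> admissibles k j" "j \<noteq> 0" using adm 3 by (auto simp: admissibles_def)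
      thus ?thesis using 3 by auto
    next
      case 4
      hence "card (crossing ?u k) = j" using C(4) a(2) by metis
      hence "?u \<in> admissibles k j" "j \<noteq> 0" using adm 4 by (auto simp: admissibles_def)
      thus ?thesis using 4 by auto
    next
      case 5
      hence "card (crossing ?u k) = Suc j" using C(5) a(2) by (metis Suc_diff_1)
      hence "?u \<in> admissibles k (Suc j)" using adm by (auto simp: admissibles_def)
      thus ?thesis using 5 by auto
    qed
  qed
  \<comment> \<open>This discards the closing steps that would lead from three crossings to
    two.\<close>
  have none: "admissibles k (Suc 2) = {}"
    using card_crossing_le_2 by (fastforce simp: admissibles_def)
  have sup: "j \<le> 1 \<Longrightarrow> open_step k u \<in> admissibles (Suc k) (Suc j)"
      "j \<le> 1 \<Longrightarrow> u \<in> admissibles (Suc k) j"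
      "0 < j \<Longrightarrow> value_step k u \<in> admissibles (Suc k) j"
      "0 < j \<Longrightarrow> position_step k u \<in> admissibles (Suc k) j"
      "0 < j \<Longrightarrow> close_step k u \<in> admissibles (Suc k) (j - 1)"
    if "u \<in> admissibles k j" for u j
    using that admissible_steps[of k u] card_crossing_steps[OF admissible_partial_permutation, of k u]
    by (auto simp: admissibles_def)
  show "admissibles (Suc k) 0 = admissibles k 0 \<union> close_step k ` admissibles k 1"
  proof
    show "admissibles (Suc k) 0 \<subseteq> admissibles k 0 \<union> close_step k ` admissibles k 1"
      using sub[of _ 0] by auto
  qed (use sup(2)[of _ 0] sup(5)[of _ 1] in auto)
  show "admissibles (Suc k) 1 = open_step k ` admissibles k 0 \<union> admissibles k 1 \<union>
     value_step k ` admissibles k 1 \<union> position_step k ` admissibles k 1 \<union>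
     close_step k ` admissibles k 2" (is "_ = ?R")
  proof
    show "admissibles (Suc k) 1 \<subseteq> ?R" using sub[of _ 1] by (auto simp: numeral_2_eq_2)
  qed (use sup(1)[of _ 0] sup(2-4)[of _ 1] sup(5)[of _ 2] in auto)
  show "admissibles (Suc k) 2 = open_step k ` admissibles k 1 \<union>
     value_step k ` admissibles k 2 \<union> position_step k ` admissibles k 2" (is "_ = ?R")
  proof
    show "admissibles (Suc k) 2 \<subseteq> ?R"
      using sub[of _ 2] none by (auto simp: numeral_2_eq_2)
  qed (use sup(1)[of _ 1] sup(3,4)[of _ 2] in \<open>auto simp: numeral_2_eq_2\<close>)
qed

lemma admissibles_0: "admissibles 0 0 = {id}" "0 < j \<Longrightarrow> admissibles 0 j = {}"
proof -
  have "admissible 0 w \<longleftrightarrow> w = id" for w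
  proof
    assume "admissible 0 w"
    from partial_permutationD(1)[OF admissible_partial_permutation[OF this]]
    show "w = id" by (simp add: fun_eq_iff)
  qed (auto simp: admissible_def partial_permutation_def)
  thus "admissibles 0 0 = {id}" "0 < j \<Longrightarrow> admissibles 0 j = {}"
    by (auto simp: admissibles_def crossing_def)
qed

lemma finite_admissibles: "finite (admissibles k j)"
proof -
  have "finite (admissibles k 0) \<and> finite (admissibles k 1) \<and> finite (admissibles k 2)"
  proof (induction k)
    case 0
    show ?case by (simp add: admissibles_0)
  next
    case (Suc k)
    thus ?case unfolding admissibles_Suc by blast
  qed
  moreover have "admissibles k j = {}" if "2 < j"
    using that card_crossing_le_2 by (fastforce simp: admissibles_def)
  moreover have "j = 0 \<or> j = 1 \<or> j = 2 \<or> 2 < j" by linarith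
  ultimately show ?thesis by auto
qed

text \<open>The five kinds of steps are told apart by the last value and by whether
  \<^term>\<open>Suc k\<close> is attained at an earlier position.\<close>

lemma step_profiles:
  assumes "u \<in> admissibles k j"
  shows "open_step k u (Suc k) = 0" "\<not> (\<exists>p \<le> k. open_step k u p = Suc k)"
    "u (Suc k) = Suc k"
    "0 < j \<Longrightarrow> value_step k u (Suc k) \<in> {1..k}" "0 < j \<Longrightarrow> \<not> (\<exists>p \<le> k. value_step k u p = Suc k)"
    "0 < j \<Longrightarrow> position_step k u (Suc k) = 0" "0 < j \<Longrightarrow> \<exists>p \<le> k. position_step k u p = Suc k"
    "0 < j \<Longrightarrow> close_step k u (Suc k) \<in> {1..k}" "0 < j \<Longrightarrow> \<exists>p \<le> k. close_step k u p = Suc k"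
proof -
  have adm: "admissible k u" and j: "card (crossing u k) = j" using assms by (auto simp: admissibles_def)
  note P = admissible_partial_permutation[OF adm]
  note P' = partial_permutationD[OF P]
  have ne: "u i \<noteq> Suc k" if "i \<le> k" for i
    using P'(1)[of i] P'(2)[of i] that by (cases "i \<in> {1..k}") auto
  show "u (Suc k) = Suc k" using P'(1)[of "Suc k"] by simp
  show "open_step k u (Suc k) = 0" "\<not> (\<exists>p \<le> k. open_step k u p = Suc k)"
    using ne by (auto simp: open_step_def)
  assume "0 < j"
  hence c: "0 < card (crossing u k)" using j by simp
  note f = first_open(1)[OF P c] first_unused(1)[OF P c]
  show "value_step k u (Suc k) \<in> {1..k}" "\<not> (\<exists>p \<le> k. value_step k u p = Suc k)"
    using f ne by (auto simp: value_step_def)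
  show "position_step k u (Suc k) = 0" "\<exists>p \<le> k. position_step k u p = Suc k"
    using f by (auto simp: position_step_def intro!: exI[of _ "first_open k u"])
  show "close_step k u (Suc k) \<in> {1..k}" "\<exists>p \<le> k. close_step k u p = Suc k"
    using f by (auto simp: close_step_def intro!: exI[of _ "first_open k u"])
qed

text \<open>Each step is injective because \<open>restriction k\<close> undoes it.\<close>

lemma card_step_images:
  "card (open_step k ` admissibles k j) = card (admissibles k j)"
  "0 < j \<Longrightarrow> card (value_step k ` admissibles k j) = card (admissibles k j)"
  "0 < j \<Longrightarrow> card (position_step k ` admissibles k j) = card (admissibles k j)"
  "0 < j \<Longrightarrow> card (close_step k ` admissibles k j) = card (admissibles k j)"
proof -
  have P: "partial_permutation k u" "card (crossing u k) = j" if "u \<in> admissibles k j" for u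
    using that by (auto simp: admissibles_def admissible_def)
  show "card (open_step k ` admissibles k j) = card (admissibles k j)"
    by (intro card_image inj_on_inverseI[of _ "restriction k"] restriction_steps(1) P)
  assume "0 < j"
  thus "card (value_step k ` admissibles k j) = card (admissibles k j)"
    "card (position_step k ` admissibles k j) = card (admissibles k j)"
    "card (close_step k ` admissibles k j) = card (admissibles k j)"
    using P by (auto intro!: card_image inj_on_inverseI[of _ "restriction k"] restriction_steps(3-5))
qed

lemma card_admissibles_Suc:
  "card (admissibles (Suc k) 0) = card (admissibles k 0) + card (admissibles k 1)"
  "card (admissibles (Suc k) 1) =
     card (admissibles k 0) + 3 * card (admissibles k 1) + card (admissibles k 2)"
  "card (admissibles (Suc k) 2) = card (admissibles k 1) + 2 * card (admissibles k 2)"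
proof -
  \<comment> \<open>These sets record the last value and whether \<open>Suc k\<close> occurs
    earlier. They place the images of the five steps in pairwise disjoint classes, so the
    cardinalities of the unions add up.\<close>
  define last where "last v = {w :: nat \<Rightarrow> nat. w (Suc k) = v}" for v
  define used where "used = {w :: nat \<Rightarrow> nat. \<exists>p \<le> k. w p = Suc k}"
  define mid where "mid = {w :: nat \<Rightarrow> nat. w (Suc k) \<in> {1..k}}"
  have O: "open_step k ` admissibles k j \<subseteq> last 0 - used" for j
    using step_profiles(1,2) by (auto simp: last_def used_def)
  have F: "admissibles k j \<subseteq> last (Suc k)" for j
    using step_profiles(3) by (auto simp: last_def)
  have U: "value_step k ` admissibles k j \<subseteq> mid - used" if "0 < j" for j
    using step_profiles(4,5) that by (auto simp: mid_def used_def)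
  have D: "position_step k ` admissibles k j \<subseteq> last 0 \<inter> used" if "0 < j" for j
    using step_profiles(6,7) that by (auto simp: last_def used_def)
  have C: "close_step k ` admissibles k j \<subseteq> mid \<inter> used" if "0 < j" for j
    using step_profiles(8,9) that by (auto simp: mid_def used_def)
  have disj: "last (Suc k) \<inter> (mid \<inter> used) = {}"
    "((last 0 - used) \<union> last (Suc k) \<union> (mid - used) \<union> (last 0 \<inter> used)) \<inter> (mid \<inter> used) = {}"
    "((last 0 - used) \<union> last (Suc k) \<union> (mid - used)) \<inter> (last 0 \<inter> used) = {}"
    "((last 0 - used) \<union> last (Suc k)) \<inter> (mid - used) = {}"
    "(last 0 - used) \<inter> last (Suc k) = {}"
    "((last 0 - used) \<union> (mid - used)) \<inter> (last 0 \<inter> used) = {}"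
    "(last 0 - used) \<inter> (mid - used) = {}"
    by (auto simp: last_def mid_def)
  have mono: "A \<inter> B = {}" if "X \<inter> Y = {}" "A \<subseteq> X" "B \<subseteq> Y" for A B X Y :: "(nat \<Rightarrow> nat) set"
    using that by blast
  have pos: "(0 :: nat) < 1" "(0 :: nat) < 2" by simp_all
  note fin = finite_admissibles finite_imageI[OF finite_admissibles]
  have "admissibles k 0 \<inter> close_step k ` admissibles k 1 = {}"
    by (rule mono[OF disj(1) F C[OF pos(1)]])
  thus "card (admissibles (Suc k) 0) = card (admissibles k 0) + card (admissibles k 1)"
    unfolding admissibles_Suc using fin by (simp add: card_Un_disjoint card_step_images)
  have d: "(open_step k ` admissibles k 0 \<union> admissibles k 1 \<union> value_step k ` admissibles k 1 \<union>
      position_step k ` admissibles k 1) \<inter> close_step k ` admissibles k 2 = {}"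
    "(open_step k ` admissibles k 0 \<union> admissibles k 1 \<union> value_step k ` admissibles k 1) \<inter>
      position_step k ` admissibles k 1 = {}"
    "(open_step k ` admissibles k 0 \<union> admissibles k 1) \<inter> value_step k ` admissibles k 1 = {}"
    "open_step k ` admissibles k 0 \<inter> admissibles k 1 = {}"
    by (rule mono[OF disj(2) Un_mono[OF Un_mono[OF Un_mono[OF O F] U[OF pos(1)]] D[OF pos(1)]] C[OF pos(2)]]
          mono[OF disj(3) Un_mono[OF Un_mono[OF O F] U[OF pos(1)]] D[OF pos(1)]]
          mono[OF disj(4) Un_mono[OF O F] U[OF pos(1)]] mono[OF disj(5) O F])+
  show "card (admissibles (Suc k) 1) =
     card (admissibles k 0) + 3 * card (admissibles k 1) + card (admissibles k 2)"
    unfolding admissibles_Suc using fin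
    by (simp add: card_Un_disjoint d card_step_images del: Int_Un_distrib2 Un_Int_distrib2 One_nat_def)
  have e: "(open_step k ` admissibles k 1 \<union> value_step k ` admissibles k 2) \<inter>
      position_step k ` admissibles k 2 = {}"
    "open_step k ` admissibles k 1 \<inter> value_step k ` admissibles k 2 = {}"
    by (rule mono[OF disj(6) Un_mono[OF O U[OF pos(2)]] D[OF pos(2)]] mono[OF disj(7) O U[OF pos(2)]])+
  show "card (admissibles (Suc k) 2) = card (admissibles k 1) + 2 * card (admissibles k 2)"
    unfolding admissibles_Suc using fin
    by (simp add: card_Un_disjoint e card_step_images del: One_nat_def)
qed

subsection \<open>The generating function\<close>

lemma num_two_boolean_eq: "num_two_boolean n = card (admissibles n 0)"
  by (simp add: num_two_boolean_def admissibles_def two_boolean_iff_admissible)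

text \<open>The transfer matrix with rows (1, 1, 0), (1, 3, 1), (0, 1, 2) has characteristic
  polynomial x^3 - 6x^2 + 9x - 3. The negative term is moved to the left to stay within the
  naturals.\<close>

lemma num_two_boolean_recurrence:
  "num_two_boolean (n + 3) + 9 * num_two_boolean (n + 1) =
     6 * num_two_boolean (n + 2) + 3 * num_two_boolean n"
proof -
  have "n + 3 = Suc (Suc (Suc n))" "n + 2 = Suc (Suc n)" "n + 1 = Suc n" by simp_all
  thus ?thesis by (simp only: num_two_boolean_eq card_admissibles_Suc) simp
qed

lemma num_two_boolean_initial:
  "num_two_boolean 0 = 1" "num_two_boolean 1 = 1" "num_two_boolean 2 = 2"
proof -
  show "num_two_boolean 0 = 1" by (simp add: num_two_boolean_eq admissibles_0)
  have "num_two_boolean (Suc 0) = 1" "num_two_boolean (Suc (Suc 0)) = 2"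
    by (simp_all add: num_two_boolean_eq card_admissibles_Suc admissibles_0 del: One_nat_def)
  thus "num_two_boolean 1 = 1" "num_two_boolean 2 = 2" by (simp_all add: numeral_2_eq_2)
qed

theorem theorem4p7:
  "(Abs_fps (\<lambda>n. of_nat (num_two_boolean n)) :: rat fps) =
     (1 - 5 * fps_X + 5 * fps_X ^ 2) / (1 - 6 * fps_X + 9 * fps_X ^ 2 - 3 * fps_X ^ 3)"
proof -
  define f :: "nat \<Rightarrow> rat" where "f n = of_nat (num_two_boolean n)" for n
  define F where "F = Abs_fps f"
  define D :: "rat fps" where "D = 1 - 6 * fps_X + 9 * fps_X ^ 2 - 3 * fps_X ^ 3"
  define N :: "rat fps" where "N = 1 - 5 * fps_X + 5 * fps_X ^ 2"
  have init: "f 0 = 1" "f (Suc 0) = 1" "f 2 = 2"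
    using num_two_boolean_initial by (simp_all add: f_def)
  have rec: "f (n + 3) = 6 * f (n + 2) - 9 * f (n + 1) + 3 * f n" for n
  proof -
    have "(of_nat (num_two_boolean (n + 3) + 9 * num_two_boolean (n + 1)) :: rat) =
        of_nat (6 * num_two_boolean (n + 2) + 3 * num_two_boolean n)"
      by (simp only: num_two_boolean_recurrence)
    thus ?thesis by (simp add: f_def)
  qed
  have F_nth: "fps_nth F n = f n" for n by (simp add: F_def)
  \<comment> \<open>Multiplied out into shifts of \<open>F\<close> with constant factors, so that
    coefficients can be read off.\<close>
  have FD: "F * D = F - fps_const 6 * (fps_X * F) + fps_const 9 * (fps_X ^ 2 * F)
      - fps_const 3 * (fps_X ^ 3 * F)"
    by (simp add: D_def numeral_fps_const[symmetric] algebra_simps)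
  have N': "N = 1 - fps_const 5 * fps_X + fps_const 5 * fps_X ^ 2"
    by (simp add: N_def numeral_fps_const[symmetric])
  have "F * D = N"
  proof (rule fps_ext)
    fix n :: nat
    \<comment> \<open>The first three coefficients 1, -5, 5 come from the initial values; from
      degree 3 on \<open>N\<close> vanishes, which is the recurrence.\<close>
    consider "n = 0" | "n = 1" | "n = 2" | m where "n = m + 3"
    proof -
      have "n \<in> {0, 1, 2} \<or> n = (n - 3) + 3" by auto
      thus thesis using that by blast
    qed
    thus "fps_nth (F * D) n = fps_nth N n"
    proof cases
      case (4 m)
      thus ?thesis using rec[of m]
        by (simp add: 4 FD N' F_nth fps_X_power_mult_nth fps_X_power_nth fps_X_nth)
    qed (simp_all add: FD N' F_nth fps_X_power_mult_nth fps_X_power_nth fps_X_nth init)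
  qed
  moreover have "D \<noteq> 0"
  proof
    assume "D = 0"
    hence "fps_nth D 0 = 0" by simp
    thus False by (simp add: D_def)
  qed
  ultimately have "F = N / D" by (metis nonzero_mult_div_cancel_right)
  thus ?thesis by (simp add: F_def f_def[abs_def] N_def D_def)
qed

end
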